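(* There exists a spacetime $(M,g)$ which is $A^{\infty}$-causal but not $K$-causal.
   Context: A spacetime $(M,g)$ is a connected, time-oriented $C^{r}$ Lorentzian manifold ($r\in\{3,\dots,\infty\}$) of dimension $n\ge 2$ and signature $(-,+,\dots,+)$. $p\ll q$ means that there is a future-directed timelike curve from $p$ to $q$; $p\le q$ means that there is a future-directed causal curve from $p$ to $q$ or $p=q$. $I^{+}=\{(p,q)\in M\times M:p\ll q\}$, $J^{+}=\{(p,q)\in M\times M:p\le q\}$, and $A^{+}=\bar{J}^{+}$ is the closure of $J^{+}$ in $M\times M$ (product topology). $K^{+}\subset M\times M$ is the smallest closed and transitive relation containing $I^{+}$; $(M,g)$ is $K$-causal if $K^{+}$ is antisymmetric, i.e. $(x,z)\in K^{+}$ and $(z,x)\in K^{+}$ imply $x=z$. For an integer $n\ge 2$, $(M,g)$ is $A^{n/2}$-causal if whenever $(x_i,x_{i+1})\in A^{+}$ for $i=1,\dots,n$ with $x_{n+1}=x_1$, then $x_i=x_1$ for all $i=1,\dots,n$. $(M,g)$ is $A^{\infty}$-causal if it is $A^{k/2}$-causal for every integer $k\ge 2$; equivalently, if the relation $A^{+\infty}=\bigcup_{i\ge 0}A^{+i}$ is antisymmetric, where $A^{+0}$ is the diagonal of $M\times M$ and, for $i\ge 1$, $A^{+i}$ is the set of pairs $(x_1,x_{i+1})$ that can be connected by a chain $(x_j,x_{j+1})\in A^{+}$, $j=1,\dots,i$. *)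

theory Defs
  imports "HOL-Analysis.Analysis" "HOL-Library.Extended_Nat"
begin

section \<open>Functions of class \<open>C\<^sup>r\<close> on open subsets of \<open>n\<close>-dimensional Euclidean space\<close>

text \<open>
  The model space is \<^const>\<open>Euclidean_space\<close> \<open>n\<close>, whose points are the functions
  \<open>nat \<Rightarrow> real\<close> vanishing from \<open>n\<close> on; the coordinates are numbered \<open>0, \<dots>, n - 1\<close>.
\<close>

definition partial_deriv :: "nat \<Rightarrow> ((nat \<Rightarrow> real) \<Rightarrow> real) \<Rightarrow> (nat \<Rightarrow> real) \<Rightarrow> real" where
  "partial_deriv i f x = deriv (\<lambda>t. f (x(i := t))) (x i)"

primrec Ck_on :: "nat \<Rightarrow> nat \<Rightarrow> (nat \<Rightarrow> real) set \<Rightarrow> ((nat \<Rightarrow> real) \<Rightarrow> real) \<Rightarrow> bool" where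
  "Ck_on n 0 V f \<longleftrightarrow> continuous_map (subtopology (Euclidean_space n) V) euclideanreal f"
| "Ck_on n (Suc k) V f \<longleftrightarrow>
     continuous_map (subtopology (Euclidean_space n) V) euclideanreal f \<and>
     (\<forall>i<n. (\<forall>x\<in>V. (\<lambda>t. f (x(i := t))) field_differentiable (at (x i))) \<and>
            Ck_on n k V (partial_deriv i f))"

definition Cr_on :: "nat \<Rightarrow> enat \<Rightarrow> (nat \<Rightarrow> real) set \<Rightarrow> ((nat \<Rightarrow> real) \<Rightarrow> real) \<Rightarrow> bool" where
  "Cr_on n r V f \<longleftrightarrow> (\<forall>k. enat k \<le> r \<longrightarrow> Ck_on n k V f)"


section \<open>Manifolds\<close>

text \<open>A chart is a pair of its domain and its coordinate map.\<close>

type_synonym 'a chart = "'a set \<times> ('a \<Rightarrow> nat \<Rightarrow> real)"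

abbreviation chart_dom :: "'a chart \<Rightarrow> 'a set" where
  "chart_dom c \<equiv> fst c"

abbreviation chart_map :: "'a chart \<Rightarrow> 'a \<Rightarrow> nat \<Rightarrow> real" where
  "chart_map c \<equiv> snd c"

abbreviation chart_inv :: "'a chart \<Rightarrow> (nat \<Rightarrow> real) \<Rightarrow> 'a" where
  "chart_inv c \<equiv> inv_into (chart_dom c) (chart_map c)"

definition is_chart :: "nat \<Rightarrow> 'a topology \<Rightarrow> 'a chart \<Rightarrow> bool" where
  "is_chart n X c \<longleftrightarrow>
     openin X (chart_dom c) \<and>
     openin (Euclidean_space n) (chart_map c ` chart_dom c) \<and>
     homeomorphic_map (subtopology X (chart_dom c))
       (subtopology (Euclidean_space n) (chart_map c ` chart_dom c)) (chart_map c)"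

definition transition :: "'a chart \<Rightarrow> 'a chart \<Rightarrow> (nat \<Rightarrow> real) \<Rightarrow> nat \<Rightarrow> real" where
  "transition c d x = chart_map d (chart_inv c x)"

text \<open>\<open>jacobian c d p k i\<close> is the partial derivative of the \<open>k\<close>-th coordinate of the chart \<open>d\<close>
  with respect to the \<open>i\<close>-th coordinate of the chart \<open>c\<close>, at the point \<open>p\<close>.\<close>

definition jacobian :: "'a chart \<Rightarrow> 'a chart \<Rightarrow> 'a \<Rightarrow> nat \<Rightarrow> nat \<Rightarrow> real" where
  "jacobian c d p k i = partial_deriv i (\<lambda>x. transition c d x k) (chart_map c p)"

definition Cr_manifold :: "enat \<Rightarrow> nat \<Rightarrow> 'a topology \<Rightarrow> 'a chart set \<Rightarrow> bool" where
  "Cr_manifold r n X \<A> \<longleftrightarrow>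
     Hausdorff_space X \<and> second_countable X \<and>
     (\<forall>c\<in>\<A>. is_chart n X c) \<and>
     (\<Union>c\<in>\<A>. chart_dom c) = topspace X \<and>
     (\<forall>c\<in>\<A>. \<forall>d\<in>\<A>. \<forall>k<n.
        Cr_on n r (chart_map c ` (chart_dom c \<inter> chart_dom d)) (\<lambda>x. transition c d x k))"


section \<open>Spacetimes\<close>

text \<open>
  Tensor fields are given by their components in each chart of the atlas: \<open>metric S c p i j\<close> and
  \<open>time_field S c p i\<close> are only meaningful for \<open>c \<in> atlas S\<close>, \<open>p \<in> chart_dom c\<close> and
  \<open>i, j < dim S\<close>. The time orientation is the one induced by the continuous timelike vector
  field \<open>time_field S\<close>.
\<close>

record 'a spacetime_data =
  dim :: nat
  topol :: "'a topology"
  atlas :: "'a chart set"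
  metric :: "'a chart \<Rightarrow> 'a \<Rightarrow> nat \<Rightarrow> nat \<Rightarrow> real"
  time_field :: "'a chart \<Rightarrow> 'a \<Rightarrow> nat \<Rightarrow> real"

definition gprod ::
    "'a spacetime_data \<Rightarrow> 'a chart \<Rightarrow> 'a \<Rightarrow> (nat \<Rightarrow> real) \<Rightarrow> (nat \<Rightarrow> real) \<Rightarrow> real" where
  "gprod S c p u v = (\<Sum>i<dim S. \<Sum>j<dim S. metric S c p i j * u i * v j)"

definition lorentzian_metric :: "enat \<Rightarrow> 'a spacetime_data \<Rightarrow> bool" where
  "lorentzian_metric s S \<longleftrightarrow>
     (\<forall>c\<in>atlas S. \<forall>p\<in>chart_dom c. \<forall>i<dim S. \<forall>j<dim S. metric S c p i j = metric S c p j i) \<and>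
     (\<forall>c\<in>atlas S. \<forall>p\<in>chart_dom c. \<exists>e :: nat \<Rightarrow> nat \<Rightarrow> real. \<forall>i<dim S. \<forall>j<dim S.
        gprod S c p (e i) (e j) = (if i = j then (if i = 0 then -1 else 1) else 0)) \<and>
     (\<forall>c\<in>atlas S. \<forall>i<dim S. \<forall>j<dim S.
        Cr_on (dim S) s (chart_map c ` chart_dom c) (\<lambda>x. metric S c (chart_inv c x) i j)) \<and>
     (\<forall>c\<in>atlas S. \<forall>d\<in>atlas S. \<forall>p\<in>chart_dom c \<inter> chart_dom d. \<forall>i<dim S. \<forall>j<dim S.
        metric S c p i j =
          (\<Sum>k<dim S. \<Sum>l<dim S. jacobian c d p k i * jacobian c d p l j * metric S d p k l))"

definition time_orientation :: "'a spacetime_data \<Rightarrow> bool" where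
  "time_orientation S \<longleftrightarrow>
     (\<forall>c\<in>atlas S. \<forall>p\<in>chart_dom c. gprod S c p (time_field S c p) (time_field S c p) < 0) \<and>
     (\<forall>c\<in>atlas S. \<forall>i<dim S.
        Cr_on (dim S) 0 (chart_map c ` chart_dom c) (\<lambda>x. time_field S c (chart_inv c x) i)) \<and>
     (\<forall>c\<in>atlas S. \<forall>d\<in>atlas S. \<forall>p\<in>chart_dom c \<inter> chart_dom d. \<forall>k<dim S.
        time_field S d p k = (\<Sum>i<dim S. jacobian c d p k i * time_field S c p i))"

text \<open>On a \<open>C\<^sup>r\<close> manifold the highest meaningful regularity of a metric is \<open>C\<^bsup>r-1\<^esup>\<close>
  (and \<open>\<infinity> - 1 = \<infinity>\<close>).\<close>

definition spacetime :: "enat \<Rightarrow> 'a spacetime_data \<Rightarrow> bool" where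
  "spacetime r S \<longleftrightarrow>
     2 \<le> dim S \<and>
     Cr_manifold r (dim S) (topol S) (atlas S) \<and>
     topspace (topol S) \<noteq> {} \<and> connected_space (topol S) \<and>
     lorentzian_metric (r - 1) S \<and>
     time_orientation S"


section \<open>Causal relations\<close>

definition future_timelike ::
    "'a spacetime_data \<Rightarrow> 'a chart \<Rightarrow> 'a \<Rightarrow> (nat \<Rightarrow> real) \<Rightarrow> bool" where
  "future_timelike S c p v \<longleftrightarrow> gprod S c p v v < 0 \<and> gprod S c p (time_field S c p) v < 0"

definition future_causal ::
    "'a spacetime_data \<Rightarrow> 'a chart \<Rightarrow> 'a \<Rightarrow> (nat \<Rightarrow> real) \<Rightarrow> bool" where
  "future_causal S c p v \<longleftrightarrow>
     (\<exists>i<dim S. v i \<noteq> 0) \<and> gprod S c p v v \<le> 0 \<and> gprod S c p (time_field S c p) v < 0"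

text \<open>\<open>C1_arc S P a b \<gamma>\<close>: the curve \<open>\<gamma>\<close> is \<open>C\<^sup>1\<close> on the interval \<open>[a, b]\<close> (one-sided derivatives at
  the endpoints) and all its velocity vectors satisfy \<open>P\<close>.\<close>

definition C1_arc ::
    "'a spacetime_data \<Rightarrow> ('a chart \<Rightarrow> 'a \<Rightarrow> (nat \<Rightarrow> real) \<Rightarrow> bool) \<Rightarrow>
     real \<Rightarrow> real \<Rightarrow> (real \<Rightarrow> 'a) \<Rightarrow> bool" where
  "C1_arc S P a b \<gamma> \<longleftrightarrow>
     continuous_map (top_of_set {a..b}) (topol S) \<gamma> \<and>
     (\<forall>c\<in>atlas S. \<exists>v :: real \<Rightarrow> nat \<Rightarrow> real.
        (\<forall>t\<in>{a..b}. \<gamma> t \<in> chart_dom c \<longrightarrow>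
           (\<forall>i<dim S. ((\<lambda>s. chart_map c (\<gamma> s) i) has_real_derivative v t i)
              (at t within {a..b})) \<and>
           P c (\<gamma> t) (v t)) \<and>
        (\<forall>i<dim S. continuous_on {t\<in>{a..b}. \<gamma> t \<in> chart_dom c} (\<lambda>t. v t i)))"

definition piecewise_C1_curve ::
    "'a spacetime_data \<Rightarrow> ('a chart \<Rightarrow> 'a \<Rightarrow> (nat \<Rightarrow> real) \<Rightarrow> bool) \<Rightarrow>
     real \<Rightarrow> real \<Rightarrow> (real \<Rightarrow> 'a) \<Rightarrow> bool" where
  "piecewise_C1_curve S P a b \<gamma> \<longleftrightarrow>
     a < b \<and> continuous_map (top_of_set {a..b}) (topol S) \<gamma> \<and>
     (\<exists>(m::nat) t :: nat \<Rightarrow> real. t 0 = a \<and> t m = b \<and>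
        (\<forall>j<m. t j < t (Suc j) \<and> C1_arc S P (t j) (t (Suc j)) \<gamma>))"

definition chron_future :: "'a spacetime_data \<Rightarrow> 'a rel" where
  "chron_future S =
     {(p, q). \<exists>a b \<gamma>. piecewise_C1_curve S (future_timelike S) a b \<gamma> \<and> \<gamma> a = p \<and> \<gamma> b = q}"

definition causal_future :: "'a spacetime_data \<Rightarrow> 'a rel" where
  "causal_future S =
     {(p, q). p \<in> topspace (topol S) \<and> q \<in> topspace (topol S) \<and>
        (p = q \<or>
         (\<exists>a b \<gamma>. piecewise_C1_curve S (future_causal S) a b \<gamma> \<and> \<gamma> a = p \<and> \<gamma> b = q))}"

definition A_rel :: "'a spacetime_data \<Rightarrow> 'a rel" where
  "A_rel S = prod_topology (topol S) (topol S) closure_of causal_future S"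

definition K_rel :: "'a spacetime_data \<Rightarrow> 'a rel" where
  "K_rel S =
     \<Inter> {R. closedin (prod_topology (topol S) (topol S)) R \<and> trans R \<and> chron_future S \<subseteq> R}"

definition K_causal :: "'a spacetime_data \<Rightarrow> bool" where
  "K_causal S \<longleftrightarrow> antisym (K_rel S)"

definition A_half_causal :: "nat \<Rightarrow> 'a spacetime_data \<Rightarrow> bool" where
  "A_half_causal k S \<longleftrightarrow>
     (\<forall>x :: nat \<Rightarrow> 'a. (\<forall>i\<in>{1..k}. (x i, x (i + 1)) \<in> A_rel S) \<and> x (k + 1) = x 1 \<longrightarrow>
        (\<forall>i\<in>{1..k}. x i = x 1))"

definition A_infinity_causal :: "'a spacetime_data \<Rightarrow> bool" where
  "A_infinity_causal S \<longleftrightarrow> (\<forall>k\<ge>2. A_half_causal k S)"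

end

theory Submission
  imports Defs
begin

text \<open>
  In a plane domain, take the metric whose causal curves are those along which both the radius and
  the angle are nondecreasing. The only obstacle to a closed causal curve is then the set of points
  removed from the plane. From the closed first quadrant remove the unit disc and a sequence of
  circular arcs with radii decreasing to 1, which cut it into rooms; each room has an entrance from
  the fourth quadrant in its upper half and an exit to the second quadrant in its lower half.
  Outside the first quadrant remove the negative real axis from \<open>-1\<close> on.

  A causal curve cannot cross a room, since it cannot descend inside it. But at the radius \<open>r\<close>
  separating the two halves a limit of causal curves leads from angle \<open>-\<pi>/2\<close> to the middle of the
  room, and another one from there to angle \<open>3\<pi>/4\<close>. As \<open>r\<close> tends to 1, the middle points run into
  a removed arc while the end points converge, so a closed transitive relation must lead from
  angle \<open>-\<pi>/2\<close> to angle \<open>3\<pi>/4\<close> on the unit circle; it also leads back, by curves of radius less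
  than 1 through the negative real axis. A finite cycle of \<open>A\<^sup>+\<close>, on the other hand, has constant
  radius, and there a suitable branch of the angle is nondecreasing along \<open>A\<^sup>+\<close>: for radius
  greater than 1 the one cut along the negative real axis, for radius at most 1 the one cut inside
  the first quadrant, because a causal curve that enters this quadrant from outside never leaves it.
\<close>

section \<open>Smoothness of polynomial functions\<close>

text \<open>A class closed under partial derivatives that contains the components of the metric and
  of the time field, so one induction yields every order of differentiability.\<close>

inductive polynomial_fun :: "((nat \<Rightarrow> real) \<Rightarrow> real) \<Rightarrow> bool" where
  const: "polynomial_fun (\<lambda>_. c)"
| coord: "polynomial_fun (\<lambda>x. x i)"
| add: "polynomial_fun f \<Longrightarrow> polynomial_fun g \<Longrightarrow> polynomial_fun (\<lambda>x. f x + g x)"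
| mult: "polynomial_fun f \<Longrightarrow> polynomial_fun g \<Longrightarrow> polynomial_fun (\<lambda>x. f x * g x)"

lemma polynomial_fun_diff:
  assumes "polynomial_fun f" "polynomial_fun g"
  shows "polynomial_fun (\<lambda>x. f x - g x)"
  using polynomial_fun.add[OF assms(1) polynomial_fun.mult[OF polynomial_fun.const[of "-1"] assms(2)]]
  by simp

lemma polynomial_fun_If:
  "polynomial_fun f \<Longrightarrow> polynomial_fun g \<Longrightarrow> polynomial_fun (\<lambda>x. if b then f x else g x)"
  by (cases b) simp_all

lemma polynomial_fun_has_partial_deriv:
  assumes "polynomial_fun f"
  shows "\<exists>f'. polynomial_fun f' \<and> (\<forall>x. ((\<lambda>t. f (x(i := t))) has_real_derivative f' x) (at (x i)))"
  using assms
proof induction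
  case (const c)
  show ?case
    by (rule exI[of _ "\<lambda>_. 0"]) (auto intro: polynomial_fun.const)
next
  case (coord j)
  show ?case
    by (rule exI[of _ "\<lambda>_. if i = j then 1 else 0"])
      (auto intro: polynomial_fun.const simp: fun_upd_def)
next
  case (add f g)
  then obtain f' g' where f': "polynomial_fun f'" "polynomial_fun g'"
    and d: "\<And>x. ((\<lambda>t. f (x(i := t))) has_real_derivative f' x) (at (x i))"
    "\<And>x. ((\<lambda>t. g (x(i := t))) has_real_derivative g' x) (at (x i))" by blast
  have "((\<lambda>t. f (x(i := t)) + g (x(i := t))) has_real_derivative f' x + g' x) (at (x i))" for x
    using DERIV_add[OF d(1)[of x] d(2)[of x]] by simp
  then show ?case
    by (intro exI[of _ "\<lambda>x. f' x + g' x"] conjI polynomial_fun.add f' allI)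
next
  case (mult f g)
  then obtain f' g' where f': "polynomial_fun f'" "polynomial_fun g'"
    and d: "\<And>x. ((\<lambda>t. f (x(i := t))) has_real_derivative f' x) (at (x i))"
    "\<And>x. ((\<lambda>t. g (x(i := t))) has_real_derivative g' x) (at (x i))" by blast
  have "((\<lambda>t. f (x(i := t)) * g (x(i := t))) has_real_derivative f' x * g x + g' x * f x) (at (x i))"
    for x using DERIV_mult[OF d(1)[of x] d(2)[of x]] by simp
  then show ?case
    by (intro exI[of _ "\<lambda>x. f' x * g x + g' x * f x"] conjI polynomial_fun.add
        polynomial_fun.mult f' mult.hyps allI)
qed

lemma Euclidean_space_eq_top_of_set: "Euclidean_space n = top_of_set {x. \<forall>i\<ge>n. x i = 0}"
  by (simp add: Euclidean_space_def euclidean_product_topology)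

lemma continuous_map_polynomial_fun:
  assumes "polynomial_fun f"
  shows "continuous_map (subtopology (Euclidean_space n) V) euclideanreal f"
proof -
  have "continuous_on UNIV f"
    using assms by induction (auto intro!: continuous_intros continuous_on_product_coordinates)
  then show ?thesis
    by (auto simp: Euclidean_space_eq_top_of_set subtopology_subtopology intro: continuous_on_subset)
qed

lemma Ck_on_polynomial_fun: "polynomial_fun f \<Longrightarrow> Ck_on n k V f"
proof (induction k arbitrary: f)
  case 0
  then show ?case by (simp add: continuous_map_polynomial_fun)
next
  case (Suc k)
  have "(\<forall>x\<in>V. (\<lambda>t. f (x(i := t))) field_differentiable at (x i)) \<and> Ck_on n k V (partial_deriv i f)" for i
  proof -
    obtain f' where f': "polynomial_fun f'"
      "\<And>x. ((\<lambda>t. f (x(i := t))) has_real_derivative f' x) (at (x i))"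
      using polynomial_fun_has_partial_deriv[OF Suc.prems] by blast
    then have "partial_deriv i f = f'"
      unfolding partial_deriv_def by (intro ext DERIV_imp_deriv)
    moreover have "(\<lambda>t. f (x(i := t))) field_differentiable at (x i)" for x
      unfolding field_differentiable_def using f'(2) by (rule exI)
    ultimately show ?thesis
      using Suc.IH[OF f'(1)] by simp
  qed
  then show ?case
    using Suc.prems by (simp add: continuous_map_polynomial_fun)
qed

text \<open>\<open>V\<close> is open only relative to the subspace of sequences vanishing from
  \<open>n\<close> on. Varying a coordinate \<open>i < n\<close> stays in that subspace, so relative
  openness suffices.\<close>

lemma eventually_fun_upd_in_openin:
  fixes x :: "nat \<Rightarrow> real"
  assumes "openin (Euclidean_space n) V" "x \<in> V" "i < n"
  shows "\<forall>\<^sub>F t in nhds (x i). x(i := t) \<in> V"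
proof -
  obtain U where U: "open U" "V = {x. \<forall>i\<ge>n. x i = 0} \<inter> U"
    using assms(1) by (auto simp: Euclidean_space_eq_top_of_set openin_open)
  have "continuous_on UNIV (\<lambda>t. x(i := t))"
  proof (rule continuous_on_coordinatewise_then_product)
    show "continuous_on UNIV (\<lambda>t. (x(i := t)) j)" for j
      by (cases "j = i") auto
  qed
  then have "open ((\<lambda>t. x(i := t)) -` U)"
    using U(1) by (intro open_vimage) auto
  moreover have "x i \<in> (\<lambda>t. x(i := t)) -` U"
    using assms(2) U by simp
  ultimately have "\<forall>\<^sub>F t in nhds (x i). t \<in> (\<lambda>t. x(i := t)) -` U"
    by (rule eventually_nhds_in_open)
  then show ?thesis
    by eventually_elim (use assms U in auto)
qed

lemma partial_deriv_cong:
  assumes "openin (Euclidean_space n) V" "\<And>y. y \<in> V \<Longrightarrow> f y = g y" "x \<in> V" "i < n"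
  shows "partial_deriv i f x = partial_deriv i g x"
  unfolding partial_deriv_def
  using eventually_fun_upd_in_openin[OF assms(1,3,4)]
  by (intro deriv_cong_ev) (auto elim!: eventually_mono simp: assms(2))

text \<open>Components in a chart are expressed through \<open>inv_into\<close>, which is controlled
  only on the chart image; there they can be replaced by polynomials. Openness of \<open>V\<close>
  makes the derivatives agree as well.\<close>

lemma Ck_on_cong:
  assumes "openin (Euclidean_space n) V"
  shows "(\<And>x. x \<in> V \<Longrightarrow> f x = g x) \<Longrightarrow> Ck_on n k V f \<Longrightarrow> Ck_on n k V g"
proof (induction k arbitrary: f g)
  case 0
  then show ?case
    by (simp, elim continuous_map_eq) simp
next
  case (Suc k)
  have "continuous_map (subtopology (Euclidean_space n) V) euclideanreal g"
    using Suc.prems by (intro continuous_map_eq[of _ _ f g]) simp_all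
  moreover have "(\<lambda>t. g (x(i := t))) field_differentiable at (x i)" if i: "i < n" "x \<in> V" for i x
  proof -
    have "\<forall>\<^sub>F t in nhds (x i). f (x(i := t)) = g (x(i := t))"
      using eventually_fun_upd_in_openin[OF assms i(2,1)]
      by eventually_elim (rule Suc.prems(1))
    then have iff: "((\<lambda>t. f (x(i := t))) has_real_derivative D) (at (x i)) \<longleftrightarrow>
        ((\<lambda>t. g (x(i := t))) has_real_derivative D) (at (x i))" for D
      by (rule DERIV_cong_ev[OF refl _ refl])
    obtain D where "((\<lambda>t. f (x(i := t))) has_real_derivative D) (at (x i))"
      using Suc.prems(2) i unfolding Ck_on.simps field_differentiable_def by blast
    then show ?thesis
      unfolding field_differentiable_def using iff by blast
  qed
  moreover have "Ck_on n k V (partial_deriv i g)" if "i < n" for i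
  proof (rule Suc.IH)
    show "partial_deriv i f x = partial_deriv i g x" if "x \<in> V" for x
      using Suc.prems(1) that \<open>i < n\<close> by (rule partial_deriv_cong[OF assms])
    show "Ck_on n k V (partial_deriv i f)"
      using Suc.prems(2) that by simp
  qed
  ultimately show ?case by simp
qed

lemma Cr_on_eq_polynomial_fun:
  assumes "openin (Euclidean_space n) V" "polynomial_fun f" "\<And>x. x \<in> V \<Longrightarrow> g x = f x"
  shows "Cr_on n r V g"
  unfolding Cr_on_def
proof (intro allI impI)
  show "Ck_on n k V g" for k
    using assms(3) by (intro Ck_on_cong[OF assms(1) _ Ck_on_polynomial_fun[OF assms(2)]]) simp
qed

section \<open>A slit domain in the plane\<close>

text \<open>It grows to infinity as \<open>r\<close> decreases to 1, so its periods cut the radii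
  above 1 into infinitely many rooms accumulating at the unit circle.\<close>

definition phase :: "real \<Rightarrow> real" where
  "phase r = 1 / (r - 1)"

definition quadrant :: "complex set" where
  "quadrant = {z. 0 \<le> Re z \<and> 0 \<le> Im z}"

text \<open>The rooms are separated by the arcs where the cosine of the phase is 1; the phase decreases with
  the radius, so its sine is positive in the upper half of each room.\<close>

definition region :: "complex set" where
  "region = {z. (Im z = 0 \<and> Re z \<le> 0 \<longrightarrow> cmod z < 1) \<and>
     (z \<in> quadrant \<longrightarrow> 1 < cmod z \<and> cos (phase (cmod z)) \<noteq> 1 \<and>
        (Im z = 0 \<longrightarrow> 0 < sin (phase (cmod z))) \<and> (Re z = 0 \<longrightarrow> sin (phase (cmod z)) < 0))}"

lemma closed_quadrant: "closed quadrant"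
  unfolding quadrant_def by (intro closed_Collect_conj closed_Collect_le continuous_intros)

lemma open_region: "open region"
proof -
  have U: "open {z::complex. 1 < cmod z}"
    by (intro open_Collect_less continuous_intros)
  have cont: "continuous_on {z. 1 < cmod z} (\<lambda>z. phase (cmod z))"
    unfolding phase_def by (intro continuous_intros) auto
  have *: "open {z. 1 < cmod z \<and> phase (cmod z) \<in> S}" if "open S" for S
    using continuous_open_preimage[OF cont U that] by (simp add: vimage_def Int_def)
  have "open {v::real. cos v \<noteq> 1}" "open {v::real. 0 < sin v}" "open {v::real. sin v < 0}"
    by (intro open_Collect_neq open_Collect_less continuous_intros)+
  note ** = this[THEN *, simplified]
  \<comment> \<open>Each implication in the definition becomes a union of open sets. As
    \<open>phase\<close> is continuous only away from 1, its conditions are paired with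
    \<open>1 < cmod z\<close>.\<close>
  have "region = ({z. Im z \<noteq> 0} \<union> {z. 0 < Re z} \<union> {z. cmod z < 1}) \<inter>
      ({z. Re z < 0} \<union> {z. Im z < 0} \<union>
        {z. 1 < cmod z \<and> cos (phase (cmod z)) \<noteq> 1} \<inter>
        ({z. Im z \<noteq> 0} \<union> {z. 1 < cmod z \<and> 0 < sin (phase (cmod z))}) \<inter>
        ({z. Re z \<noteq> 0} \<union> {z. 1 < cmod z \<and> sin (phase (cmod z)) < 0}))"
    unfolding region_def quadrant_def by (auto simp: not_le)
  also have "open \<dots>"
    by (intro open_Int open_Un ** open_Collect_neq open_Collect_less continuous_intros)
  finally show ?thesis .
qed

text \<open>Modulo \<open>2 * pi\<close>, \<open>u\<close> lies in (0, pi], so the sine is positive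
  from the preceding multiple of \<open>2 * pi\<close> up to \<open>u\<close>. Allowing
  \<open>sin u = 0\<close> covers the radius that separates the halves of a room.\<close>

lemma sin_pos_below:
  fixes u :: real
  assumes "0 \<le> sin u" "cos u \<noteq> 1"
  shows "\<exists>d>0. \<forall>v. u - d < v \<and> v < u \<longrightarrow> 0 < sin v"
proof -
  define n where "n = \<lfloor>u / (2 * pi)\<rfloor>"
  define x where "x = u - 2 * pi * n"
  have x: "0 \<le> x" "x < 2 * pi"
    unfolding x_def n_def using floor_divide_lower[of "2 * pi" u] floor_divide_upper[of "2 * pi" u]
    by (auto simp: algebra_simps)
  have per: "sin (v + 2 * pi * n) = sin v" "cos (v + 2 * pi * n) = cos v" for v
    by (simp_all add: sin_add cos_add sin_int_2pin cos_int_2pin)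
  have "sin u = sin x" "cos u = cos x"
    using per[of x] by (simp_all add: x_def)
  then have "x \<noteq> 0" "x \<le> pi"
    using assms x sin_lt_zero[of x] by force+
  have "0 < sin v" if "u - x < v" "v < u" for v
    using sin_gt_zero[of "v - 2 * pi * n"] per(1)[of "v - 2 * pi * n"] that \<open>x \<le> pi\<close>
    by (simp add: x_def)
  then show ?thesis
    using x \<open>x \<noteq> 0\<close> by (intro exI[of _ x]) auto
qed

lemma sin_neg_above:
  fixes u :: real
  assumes "sin u \<le> 0" "cos u \<noteq> 1"
  shows "\<exists>d>0. \<forall>v. u < v \<and> v < u + d \<longrightarrow> sin v < 0"
proof -
  obtain d where "d > 0" "\<And>v. - u - d < v \<and> v < - u \<Longrightarrow> 0 < sin v"
    using sin_pos_below[of "- u"] assms by auto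
  from this(1) this(2)[of "- v" for v] show ?thesis
    by (intro exI[of _ d]) auto
qed

text \<open>The largest multiple of \<open>2 * pi\<close> not above \<open>u\<close> cannot lie
  below \<open>v\<close>, since \<open>v\<close> would then be in the same positive half period.
  Geometrically, moving outwards from the upper half of a room to a radius with nonpositive sine
  meets a removed arc.\<close>

lemma cos_eq_1_between:
  fixes u v :: real
  assumes "v \<le> u" "0 < sin u" "sin v \<le> 0"
  shows "\<exists>w\<in>{v..u}. cos w = 1"
proof -
  define n where "n = \<lfloor>u / (2 * pi)\<rfloor>"
  define x where "x = u - 2 * pi * n"
  have x: "0 \<le> x" "x < 2 * pi"
    unfolding x_def n_def using floor_divide_lower[of "2 * pi" u] floor_divide_upper[of "2 * pi" u]
    by (auto simp: algebra_simps)
  have per: "sin (y + 2 * pi * n) = sin y" for y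
    by (simp add: sin_add sin_int_2pin cos_int_2pin)
  have "sin u = sin x"
    using per[of x] by (simp add: x_def)
  then have "x < pi"
    using assms x sin_le_zero[of x] by force
  have "v \<le> 2 * pi * n"
  proof (rule ccontr)
    assume "\<not> v \<le> 2 * pi * n"
    then have "0 < sin (v - 2 * pi * n)"
      using assms(1) \<open>x < pi\<close> by (intro sin_gt_zero) (auto simp: x_def)
    then show False
      using per[of "v - 2 * pi * n"] assms(3) by simp
  qed
  then show ?thesis
    using x by (intro bexI[of _ "2 * pi * n"]) (auto simp: x_def cos_int_2pin)
qed

section \<open>Behaviour of the phase as the radius varies\<close>

lemma phase_antimono: "1 < r \<Longrightarrow> r \<le> s \<Longrightarrow> phase s \<le> phase r"
  unfolding phase_def by (intro divide_left_mono) auto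

lemma phase_strict_antimono: "1 < r \<Longrightarrow> r < s \<Longrightarrow> phase s < phase r"
  unfolding phase_def by (intro divide_strict_left_mono) auto

lemma continuous_on_phase: "continuous_on {1<..} phase"
  unfolding phase_def by (intro continuous_intros) auto

lemma sin_phase_pos_above:
  assumes "1 < r" "0 \<le> sin (phase r)" "cos (phase r) \<noteq> 1"
  shows "\<exists>R>r. \<forall>s. r < s \<and> s < R \<longrightarrow> 0 < sin (phase s)"
proof -
  obtain d where d: "d > 0" "\<And>v. phase r - d < v \<Longrightarrow> v < phase r \<Longrightarrow> 0 < sin v"
    using sin_pos_below[OF assms(2,3)] by blast
  have "isCont phase r"
    using continuous_on_phase assms(1) by (simp add: continuous_on_eq_continuous_at)
  then have "\<forall>\<^sub>F s in at r. phase r - d < phase s"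
    using d(1) by (intro order_tendstoD(1)) (auto simp: isCont_def)
  then have "\<forall>\<^sub>F s in at_right r. phase r - d < phase s"
    by (rule filter_leD[rotated]) (simp add: at_le)
  then obtain R where "R > r" "\<And>s. r < s \<Longrightarrow> s < R \<Longrightarrow> phase r - d < phase s"
    unfolding eventually_at_right_field by blast
  then show ?thesis
    using d(2) phase_strict_antimono[OF assms(1)] by blast
qed

lemma sin_phase_neg_below:
  assumes "1 < r" "sin (phase r) \<le> 0" "cos (phase r) \<noteq> 1"
  shows "\<exists>R<r. 1 \<le> R \<and> (\<forall>s. R < s \<and> s < r \<longrightarrow> sin (phase s) < 0)"
proof -
  obtain d where d: "d > 0" "\<And>v. phase r < v \<Longrightarrow> v < phase r + d \<Longrightarrow> sin v < 0"
    using sin_neg_above[OF assms(2,3)] by blast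
  have "isCont phase r"
    using continuous_on_phase assms(1) by (simp add: continuous_on_eq_continuous_at)
  then have "\<forall>\<^sub>F s in at r. phase s < phase r + d"
    using d(1) by (intro order_tendstoD(2)) (auto simp: isCont_def)
  then have "\<forall>\<^sub>F s in at_left r. phase s < phase r + d"
    by (rule filter_leD[rotated]) (simp add: at_le)
  then obtain R where "R < r" "\<And>s. R < s \<Longrightarrow> s < r \<Longrightarrow> phase s < phase r + d"
    unfolding eventually_at_left_field by blast
  then show ?thesis
    \<comment> \<open>The lower bound is raised to at least 1 because
      \<open>phase_strict_antimono\<close> covers only radii above 1.\<close>
    using d(2) phase_strict_antimono assms(1) by (intro exI[of _ "max 1 R"]) auto
qed

text \<open>Just outside \<open>r\<close> the entrance is open and no arc is met, so only the exit
  side and the negative real axis can obstruct. This serves both connectedness and the crossing of a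
  room in the limit.\<close>

lemma region_above:
  assumes "1 < r" "0 \<le> sin (phase r)" "cos (phase r) \<noteq> 1"
  obtains R where "r < R"
    "\<And>w. r < cmod w \<Longrightarrow> cmod w < R \<Longrightarrow> \<not> (Re w = 0 \<and> 0 \<le> Im w) \<Longrightarrow> \<not> (Im w = 0 \<and> Re w \<le> 0) \<Longrightarrow> w \<in> region"
proof -
  obtain R where R: "R > r" "\<And>s. r < s \<Longrightarrow> s < R \<Longrightarrow> 0 < sin (phase s)"
    using sin_phase_pos_above[OF assms] by blast
  show ?thesis
  proof
    fix w assume w: "r < cmod w" "cmod w < R" "\<not> (Re w = 0 \<and> 0 \<le> Im w)" "\<not> (Im w = 0 \<and> Re w \<le> 0)"
    have "0 < sin (phase (cmod w))" using w R by blast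
    moreover have "cos (phase (cmod w)) \<noteq> 1"
      using calculation cos_one_sin_zero by force
    ultimately show "w \<in> region"
      using w assms(1) by (auto simp: region_def quadrant_def)
  qed (fact R)
qed

text \<open>Just inside \<open>r\<close> the exit is open, so only the real axis can obstruct: its
  positive part closes the entrance, its negative part is the slit.\<close>

lemma region_below:
  assumes "1 < r" "sin (phase r) \<le> 0" "cos (phase r) \<noteq> 1"
  obtains R where "R < r" "1 \<le> R"
    "\<And>w. R < cmod w \<Longrightarrow> cmod w < r \<Longrightarrow> Im w \<noteq> 0 \<Longrightarrow> w \<in> region"
proof -
  obtain R where R: "R < r" "1 \<le> R" "\<And>s. R < s \<Longrightarrow> s < r \<Longrightarrow> sin (phase s) < 0"
    using sin_phase_neg_below[OF assms] by blast
  show ?thesis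
  proof
    fix w assume w: "R < cmod w" "cmod w < r" "Im w \<noteq> 0"
    have "sin (phase (cmod w)) < 0" using w R by blast
    moreover have "cos (phase (cmod w)) \<noteq> 1"
      using calculation cos_one_sin_zero by force
    ultimately show "w \<in> region"
      using w R(2) by (auto simp: region_def quadrant_def)
  qed (fact R)+
qed

text \<open>The part \<open>B\<close> outside the quadrant is a chain of three overlapping convex
  sets. A point of a room is joined to it by a spiral: outwards and clockwise through the entrance
  if the sine is nonnegative, inwards and counterclockwise through the exit otherwise.\<close>

lemma connected_region: "connected region"
proof -
  define B where "B = {z. Re z < 0 \<and> 0 < Im z} \<union> {z. Re z < 0 \<and> cmod z < 1} \<union> {z. Im z < 0}"
  have "{z. Re z < 0 \<and> 0 < Im z} = {z. Re z < 0} \<inter> {z. 0 < Im z}"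
    by auto
  then have conn: "connected {z. Re z < 0 \<and> 0 < Im z}"
    by (simp add: convex_connected convex_Int convex_halfspace_Re_lt convex_halfspace_Im_gt)
  have "{z. Re z < 0 \<and> cmod z < 1} = {z. Re z < 0} \<inter> ball 0 1"
    by auto
  then have conn2: "connected {z. Re z < 0 \<and> cmod z < 1}"
    by (simp add: convex_connected convex_Int convex_halfspace_Re_lt)
  have conn3: "connected {z. Im z < 0}"
    by (intro convex_connected convex_halfspace_Im_lt)
  have "Complex (-1/2) (1/2) \<in> {z. Re z < 0 \<and> 0 < Im z} \<inter> {z. Re z < 0 \<and> cmod z < 1}"
    by (simp add: cmod_def power2_eq_square real_sqrt_lt_1_iff)
  then have "connected ({z. Re z < 0 \<and> 0 < Im z} \<union> {z. Re z < 0 \<and> cmod z < 1})"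
    by (intro connected_Un conn conn2) blast
  moreover have "Complex (-1/2) (-1/2) \<in>
      ({z. Re z < 0 \<and> 0 < Im z} \<union> {z. Re z < 0 \<and> cmod z < 1}) \<inter> {z. Im z < 0}"
    by (simp add: cmod_def power2_eq_square real_sqrt_lt_1_iff)
  then have "({z. Re z < 0 \<and> 0 < Im z} \<union> {z. Re z < 0 \<and> cmod z < 1}) \<inter> {z. Im z < 0} \<noteq> {}"
    by blast
  ultimately have "connected B"
    unfolding B_def by (rule connected_Un[OF _ conn3])
  have "- \<i> \<in> B"
    by (simp add: B_def)
  then have "B \<noteq> {}"
    by blast
  have "B \<subseteq> region"
    by (auto simp: B_def region_def quadrant_def)
  have compl: "z \<in> B" if "z \<in> region" "z \<notin> quadrant" for z
    using that by (cases "Im z" "0::real" rule: linorder_cases) (auto simp: B_def region_def quadrant_def)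
  have arcI: "\<exists>C\<subseteq>region. connected C \<and> z \<in> C \<and> C \<inter> B \<noteq> {}"
    if "\<And>s. 0 \<le> s \<Longrightarrow> s \<le> 1 \<Longrightarrow> f s \<in> region" "f 0 = z" "f 1 \<in> B" "connected (f ` {0..1})"
    for f :: "real \<Rightarrow> complex" and z
  proof (intro exI conjI)
    show "f ` {0..1} \<subseteq> region"
      using that(1) by auto
    show "z \<in> f ` {0..1}"
      using that(2) by (intro image_eqI[of _ _ 0]) auto
    have "f 1 \<in> f ` {0..1} \<inter> B"
      using that(3) by simp
    then show "f ` {0..1} \<inter> B \<noteq> {}"
      by blast
  qed (fact that)
  have arc: "\<exists>C\<subseteq>region. connected C \<and> z \<in> C \<and> C \<inter> B \<noteq> {}" if z: "z \<in> region" for z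
  proof (cases "z \<in> quadrant")
    case False
    then show ?thesis
      using compl[OF z] z by (intro exI[of _ "{z}"]) auto
  next
    case True
    define r \<alpha> where "r = cmod z" and "\<alpha> = Arg z"
    have r: "1 < r" "cos (phase r) \<noteq> 1"
      using True z by (auto simp: region_def r_def)
    have z_eq: "z = rcis r \<alpha>"
      by (simp add: r_def \<alpha>_def rcis_cmod_Arg)
    have \<alpha>: "0 \<le> \<alpha>" "\<alpha> \<le> pi / 2"
      using True Arg_less_0[of z] Arg_Re_nonneg[of z] by (auto simp: quadrant_def \<alpha>_def)
    have path: "connected ((\<lambda>s. rcis (r * (1 + \<delta> * s)) (\<alpha> + (\<beta> - \<alpha>) * s)) ` {0..1})" for \<delta> \<beta>
      unfolding rcis_def cis_conv_exp by (intro connected_continuous_image continuous_intros) auto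
    show ?thesis
    proof (cases "0 \<le> sin (phase r)")
      case pos: True
      have "\<alpha> \<noteq> pi / 2"
      proof
        assume "\<alpha> = pi / 2"
        then have "Re z = r * cos (pi / 2)"
          using Re_rcis[of r \<alpha>] z_eq by metis
        then have "Re z = 0"
          by (simp only: cos_pi_half mult_zero_right)
        then show False
          using z True pos by (auto simp: region_def r_def)
      qed
      obtain R where R: "r < R" "\<And>w. r < cmod w \<Longrightarrow> cmod w < R \<Longrightarrow> \<not> (Re w = 0 \<and> 0 \<le> Im w) \<Longrightarrow>
          \<not> (Im w = 0 \<and> Re w \<le> 0) \<Longrightarrow> w \<in> region"
        using region_above[OF r(1) pos r(2)] by metis
      \<comment> \<open>The final radius \<open>r * (1 + \<delta>)\<close> is midway between
        \<open>r\<close> and \<open>R\<close>. In the other case below the same formula gives a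
        negative \<open>\<delta>\<close>.\<close>
      define \<delta> where "\<delta> = (R / r - 1) / 2"
      define f where "f s = rcis (r * (1 + \<delta> * s)) (\<alpha> + (- pi / 4 - \<alpha>) * s)" for s
      have \<delta>: "0 < \<delta>" "r * (1 + \<delta>) < R"
        using R(1) r by (auto simp: \<delta>_def field_simps)
      have "f s \<in> region" if s: "0 \<le> s" "s \<le> 1" for s
      \<comment> \<open>The start has radius exactly \<open>r\<close>, outside the open range that
        \<open>R\<close> provides, but it is \<open>z\<close> itself.\<close>
      proof (cases "s = 0")
        case True
        then show ?thesis using z by (simp add: f_def z_eq)
      next
        case False
        have rad: "r < r * (1 + \<delta> * s)"
          using False s r \<delta> by simp
        moreover have "r * (1 + \<delta> * s) < R"
          using s \<delta> r by (intro le_less_trans[OF _ \<delta>(2)]) (auto intro!: mult_left_le)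
        moreover have "cmod (f s) = r * (1 + \<delta> * s)"
          using rad r by (simp add: f_def)
        moreover have "0 < cos (\<alpha> + (- pi / 4 - \<alpha>) * s)"
        proof (rule cos_gt_zero_pi)
          have "\<alpha> + (- pi / 4 - \<alpha>) * s = (1 - s) * \<alpha> - s * (pi / 4)"
            by (simp add: algebra_simps)
          moreover have "(1 - s) * \<alpha> \<le> \<alpha>" "0 \<le> (1 - s) * \<alpha>" "s * (pi / 4) \<le> pi / 4" "0 \<le> s * (pi / 4)"
            using s \<alpha> by (auto intro: mult_left_le_one_le)
          ultimately show "- (pi / 2) < \<alpha> + (- pi / 4 - \<alpha>) * s" "\<alpha> + (- pi / 4 - \<alpha>) * s < pi / 2"
            using \<alpha> \<open>\<alpha> \<noteq> pi / 2\<close> pi_gt_zero by linarith+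
        qed
        then have "0 < Re (f s)"
          using rad r by (simp add: f_def)
        ultimately show ?thesis
          by (intro R(2)) auto
      qed
      moreover have "f 0 = z"
        by (simp add: f_def z_eq)
      moreover have "f 1 \<in> B"
        using r \<delta> by (simp add: f_def B_def sin_45)
      moreover have "connected (f ` {0..1})"
        using path[of \<delta> "- pi / 4"] unfolding f_def .
      ultimately show ?thesis
        by (rule arcI[of f])
    next
      case neg: False
      have "\<alpha> \<noteq> 0"
      proof
        assume "\<alpha> = 0"
        then have "Im z = 0" by (simp add: z_eq)
        then show False
          using z True neg by (auto simp: region_def r_def)
      qed
      obtain R where R: "R < r" "1 \<le> R" "\<And>w. R < cmod w \<Longrightarrow> cmod w < r \<Longrightarrow> Im w \<noteq> 0 \<Longrightarrow> w \<in> region"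
        using region_below[OF r(1) _ r(2)] neg by (metis linorder_not_less order_less_imp_le)
      define \<delta> where "\<delta> = (R / r - 1) / 2"
      define f where "f s = rcis (r * (1 + \<delta> * s)) (\<alpha> + (3 * pi / 4 - \<alpha>) * s)" for s
      have \<delta>: "\<delta> < 0" "R < r * (1 + \<delta>)"
        using R(1) r by (auto simp: \<delta>_def field_simps)
      have "f s \<in> region" if s: "0 \<le> s" "s \<le> 1" for s
      proof (cases "s = 0")
        case True
        then show ?thesis using z by (simp add: f_def z_eq)
      next
        case False
        have "r * (1 + \<delta> * s) < r"
          using False s r \<delta> by (simp add: mult_neg_pos)
        moreover have rad: "R < r * (1 + \<delta> * s)"
        proof -
          have "\<delta> \<le> \<delta> * s"
            using s \<delta> by (simp add: mult_le_cancel_left1)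
          then show ?thesis
            using r by (intro less_le_trans[OF \<delta>(2)]) simp
        qed
        moreover have "cmod (f s) = r * (1 + \<delta> * s)"
          using rad R(2) by (simp add: f_def)
        moreover have "0 < sin (\<alpha> + (3 * pi / 4 - \<alpha>) * s)"
        proof (rule sin_gt_zero)
          have "\<alpha> + (3 * pi / 4 - \<alpha>) * s = (1 - s) * \<alpha> + s * (3 * pi / 4)"
            by (simp add: algebra_simps)
          moreover have "(1 - s) * \<alpha> \<le> (1 - s) * (3 * pi / 4)" "0 \<le> (1 - s) * \<alpha>"
            using s \<alpha> by (intro mult_left_mono mult_nonneg_nonneg; simp)+
          moreover have "(1 - s) * (3 * pi / 4) + s * (3 * pi / 4) = 3 * pi / 4"
            by (simp add: field_simps)
          moreover have "0 < s * (3 * pi / 4)"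
            using s False by simp
          moreover have "3 * pi / 4 < pi"
            by simp
          ultimately show "0 < \<alpha> + (3 * pi / 4 - \<alpha>) * s" "\<alpha> + (3 * pi / 4 - \<alpha>) * s < pi"
            using pi_gt_zero by linarith+
        qed
        then have "0 < Im (f s)"
          using rad R(2) by (simp add: f_def)
        ultimately show ?thesis
          by (intro R(3)) auto
      qed
      moreover have "f 0 = z"
        by (simp add: f_def z_eq)
      moreover have "f 1 \<in> B"
      proof -
        have "cos (3 * pi / 4) < 0" "0 < sin (3 * pi / 4)"
          using cos_gt_zero_pi[of "pi / 4"] cos_minus_pi[of "pi/4"] sin_gt_zero[of "3 * pi / 4"]
          by (auto simp: cos_diff)
        then show ?thesis
          using \<delta> R(2) by (simp add: f_def B_def mult_pos_neg)
      qed
      moreover have "connected (f ` {0..1})"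
        using path[of \<delta> "3 * pi / 4"] unfolding f_def .
      ultimately show ?thesis
        by (rule arcI[of f])
    qed
  qed
  define \<C> where "\<C> = {C. C \<subseteq> region \<and> connected C \<and> C \<inter> B \<noteq> {}}"
  \<comment> \<open>The sets \<open>C \<union> B\<close> are connected and share \<open>B\<close>,
    so their union is connected.\<close>
  have "region = \<Union>((\<lambda>C. C \<union> B) ` \<C>)"
  proof (rule set_eqI, rule iffI)
    fix z assume "z \<in> region"
    then obtain C where "C \<in> \<C>" "z \<in> C"
      using arc[of z] unfolding \<C>_def by blast
    then show "z \<in> \<Union>((\<lambda>C. C \<union> B) ` \<C>)"
      by (intro UN_I[of C]) auto
  next
    fix z assume "z \<in> \<Union>((\<lambda>C. C \<union> B) ` \<C>)"
    then show "z \<in> region"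
      using \<open>B \<subseteq> region\<close> unfolding \<C>_def by fast
  qed
  moreover have "connected (\<Union>((\<lambda>C. C \<union> B) ` \<C>))"
  proof (rule connected_Union)
    fix S assume "S \<in> (\<lambda>C. C \<union> B) ` \<C>"
    then obtain C where "S = C \<union> B" "connected C" "C \<inter> B \<noteq> {}"
      unfolding \<C>_def by blast
    then show "connected S"
      by (simp add: connected_Un \<open>connected B\<close>)
  next
    show "\<Inter>((\<lambda>C. C \<union> B) ` \<C>) \<noteq> {}"
      using \<open>B \<noteq> {}\<close> by blast
  qed
  ultimately show ?thesis by simp
qed

section \<open>Causal paths\<close>

text \<open>A derivative-free form of causality. The factor \<open>w\<close> rotates the cut of
  \<open>Arg\<close>, so every branch of the angle must be nondecreasing as long as its cut is
  avoided; \<open>w = 1\<close> cuts along the negative real axis, \<open>w = - 1\<close> along the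
  positive one.\<close>

definition causal_path :: "(real \<Rightarrow> complex) \<Rightarrow> real \<Rightarrow> real \<Rightarrow> bool" where
  "causal_path \<gamma> a b \<longleftrightarrow> continuous_on {a..b} \<gamma> \<and> \<gamma> ` {a..b} \<subseteq> region \<and>
     (\<forall>s t. a \<le> s \<and> s \<le> t \<and> t \<le> b \<longrightarrow> cmod (\<gamma> s) \<le> cmod (\<gamma> t)) \<and>
     (\<forall>w s t. a \<le> s \<and> s \<le> t \<and> t \<le> b \<and> (\<forall>\<tau>\<in>{s..t}. w * \<gamma> \<tau> \<notin> \<real>\<^sub>\<le>\<^sub>0) \<longrightarrow> Arg (w * \<gamma> s) \<le> Arg (w * \<gamma> t))"

lemma causal_pathD:
  assumes "causal_path \<gamma> a b"
  shows causal_path_continuous: "continuous_on {a..b} \<gamma>"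
    and causal_path_in_region: "t \<in> {a..b} \<Longrightarrow> \<gamma> t \<in> region"
    and causal_path_cmod_mono: "a \<le> s \<Longrightarrow> s \<le> t \<Longrightarrow> t \<le> b \<Longrightarrow> cmod (\<gamma> s) \<le> cmod (\<gamma> t)"
    and causal_path_Arg_mono: "a \<le> s \<Longrightarrow> s \<le> t \<Longrightarrow> t \<le> b \<Longrightarrow> (\<And>\<tau>. \<tau> \<in> {s..t} \<Longrightarrow> w * \<gamma> \<tau> \<notin> \<real>\<^sub>\<le>\<^sub>0) \<Longrightarrow>
      Arg (w * \<gamma> s) \<le> Arg (w * \<gamma> t)"
  using assms unfolding causal_path_def by blast+

text \<open>Both monotonicity conditions compose at the junction \<open>m\<close>. This glues the
  pieces of a piecewise differentiable curve.\<close>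

lemma causal_path_join:
  assumes "causal_path \<gamma> a m" "causal_path \<gamma> m b" "a \<le> m" "m \<le> b"
  shows "causal_path \<gamma> a b"
  unfolding causal_path_def
proof (intro conjI allI impI)
  have ivl: "{a..b} = {a..m} \<union> {m..b}"
    using assms(3,4) by auto
  show "continuous_on {a..b} \<gamma>"
    unfolding ivl using assms by (intro continuous_on_closed_Un) (auto simp: causal_path_def)
  show "\<gamma> ` {a..b} \<subseteq> region"
    unfolding ivl image_Un using assms by (auto simp: causal_path_def)
  have split: "P s t" if "\<And>s t. a \<le> s \<and> s \<le> t \<and> t \<le> m \<Longrightarrow> P s t" "\<And>s t. m \<le> s \<and> s \<le> t \<and> t \<le> b \<Longrightarrow> P s t"
    "s < m \<Longrightarrow> m < t \<Longrightarrow> P s m \<Longrightarrow> P m t \<Longrightarrow> P s t" "a \<le> s" "s \<le> t" "t \<le> b" for P s t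
  proof -
    consider "t \<le> m" | "m \<le> s" | "s < m" "m < t"
      by linarith
    then show ?thesis
      using that(1)[of s t] that(2)[of s t] that(1)[of s m] that(2)[of m t] that(3-) by cases auto
  qed
  show "cmod (\<gamma> s) \<le> cmod (\<gamma> t)" if "a \<le> s \<and> s \<le> t \<and> t \<le> b" for s t
  proof (rule split[of "\<lambda>s t. cmod (\<gamma> s) \<le> cmod (\<gamma> t)"])
    show "cmod (\<gamma> s) \<le> cmod (\<gamma> m) \<Longrightarrow> cmod (\<gamma> m) \<le> cmod (\<gamma> t) \<Longrightarrow> cmod (\<gamma> s) \<le> cmod (\<gamma> t)"
      by (rule order_trans)
  qed (use assms(1,2) that in \<open>auto simp: causal_path_def\<close>)
  show "Arg (w * \<gamma> s) \<le> Arg (w * \<gamma> t)"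
    if "a \<le> s \<and> s \<le> t \<and> t \<le> b \<and> (\<forall>\<tau>\<in>{s..t}. w * \<gamma> \<tau> \<notin> \<real>\<^sub>\<le>\<^sub>0)" for w s t
  proof -
    define P where "P s t \<longleftrightarrow> ((\<forall>\<tau>\<in>{s..t}. w * \<gamma> \<tau> \<notin> \<real>\<^sub>\<le>\<^sub>0) \<longrightarrow> Arg (w * \<gamma> s) \<le> Arg (w * \<gamma> t))" for s t
    have "P s t"
    proof (rule split[of P])
      show "P s t" if "s < m" "m < t" "P s m" "P m t"
        using that unfolding P_def by (auto intro: order_trans[of _ "Arg (w * \<gamma> m)"])
    qed (use assms(1,2) that in \<open>auto simp: causal_path_def P_def\<close>)
    then show ?thesis
      using that by (simp add: P_def)
  qed
qed

section \<open>Paths with both ends outside the quadrant\<close>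

lemma continuous_on_nearby:
  fixes \<gamma> :: "real \<Rightarrow> 'a::topological_space"
  assumes "continuous_on S \<gamma>" "t \<in> S" "open U" "\<gamma> t \<in> U"
  shows "\<exists>e>0. \<forall>s\<in>S. \<bar>s - t\<bar> < e \<longrightarrow> \<gamma> s \<in> U"
proof -
  obtain A where A: "open A" "A \<inter> S = \<gamma> -` U \<inter> S"
    using assms(1,3) unfolding continuous_on_open_invariant by blast
  moreover have "t \<in> A"
    using A(2) assms(2,4) by blast
  ultimately obtain e where "e > 0" "ball t e \<subseteq> A"
    using open_contains_ball by blast
  moreover have "\<gamma> s \<in> U" if "s \<in> S" "\<bar>s - t\<bar> < e" for s
  proof -
    have "s \<in> ball t e"
      using that(2) by (simp add: dist_real_def abs_minus_commute)
    then have "s \<in> A \<inter> S"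
      using \<open>ball t e \<subseteq> A\<close> that(1) by blast
    then show ?thesis
      using A(2) by blast
  qed
  ultimately show ?thesis by blast
qed

text \<open>A path enters the closed quadrant through the positive real axis, in the upper half of a room,
  and can only rise inside that room, whose upper half has no exit.\<close>

lemma causal_path_avoids_quadrant:
  assumes path: "causal_path \<gamma> a b" and ends: "\<gamma> a \<notin> quadrant" "\<gamma> b \<notin> quadrant" and "t \<in> {a..b}"
  shows "\<gamma> t \<notin> quadrant"
proof
  assume "\<gamma> t \<in> quadrant"
  note cont = causal_path_continuous[OF path] and reg = causal_path_in_region[OF path]
    and mono = causal_path_cmod_mono[OF path]
  have Arg_mono: "Arg (\<gamma> s) \<le> Arg (\<gamma> t)"
    if "a \<le> s" "s \<le> t" "t \<le> b" "\<And>\<tau>. \<tau> \<in> {s..t} \<Longrightarrow> \<gamma> \<tau> \<notin> \<real>\<^sub>\<le>\<^sub>0" for s t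
    using causal_path_Arg_mono[OF path that(1-3), of 1] that(4) by simp
  \<comment> \<open>The set of times spent in the quadrant is compact, which gives a first entry
    time \<open>t0\<close>.\<close>
  define T where "T = {a..b} \<inter> \<gamma> -` quadrant"
  have "closed T"
    unfolding T_def by (intro continuous_closed_preimage cont closed_quadrant closed_atLeastAtMost)
  moreover have "bounded T"
    unfolding T_def by (rule bounded_subset[OF bounded_closed_interval[of a b]]) auto
  ultimately have "compact T"
    by (simp add: compact_eq_bounded_closed)
  moreover have "T \<noteq> {}"
    using assms(4) \<open>\<gamma> t \<in> quadrant\<close> by (auto simp: T_def)
  ultimately obtain t0 where t0: "t0 \<in> T" "\<And>s. s \<in> T \<Longrightarrow> t0 \<le> s"
    using compact_attains_inf[of T] by blast
  have t0ab: "a < t0" "t0 < b" "t0 \<in> {a..b}" "\<gamma> t0 \<in> quadrant"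
    using t0(1) ends by (auto simp: T_def less_le)
  have before: "\<gamma> s \<notin> quadrant" if "a \<le> s" "s < t0" for s
    using t0(2)[of s] that t0ab by (auto simp: T_def)
  have near_before: "\<exists>s. a \<le> s \<and> s < t0 \<and> \<gamma> s \<notin> quadrant \<and> (\<forall>\<tau>\<in>{s..t0}. \<gamma> \<tau> \<in> U)"
    if U: "open U" "\<gamma> t0 \<in> U" for U
  proof -
    obtain e where e: "e > 0" "\<And>s. s \<in> {a..b} \<Longrightarrow> \<bar>s - t0\<bar> < e \<Longrightarrow> \<gamma> s \<in> U"
      using continuous_on_nearby[OF cont t0ab(3) U] by blast
    define s where "s = max a (t0 - e / 2)"
    have "a \<le> s" "s < t0" "t0 - s < e"
      using e(1) t0ab by (auto simp: s_def)
    then show ?thesis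
      using before t0ab by (intro exI[of _ s]) (auto intro!: e(2))
  qed
  have "Re (\<gamma> t0) \<noteq> 0 \<or> Im (\<gamma> t0) \<noteq> 0"
    using reg[OF t0ab(3)] t0ab(4) by (auto simp: region_def)
  \<comment> \<open>An entry at positive height would come from the second quadrant, from an angle
    above \<open>pi / 2\<close>, whereas the angle cannot decrease.\<close>
  moreover have "Im (\<gamma> t0) = 0"
  proof (rule ccontr)
    assume "Im (\<gamma> t0) \<noteq> 0"
    then have "0 < Im (\<gamma> t0)"
      using t0ab(4) by (auto simp: quadrant_def)
    moreover have "open {z. 0 < Im z}"
      by (intro open_Collect_less continuous_intros)
    ultimately obtain s where s: "a \<le> s" "s < t0" "\<gamma> s \<notin> quadrant" and "\<forall>\<tau>\<in>{s..t0}. \<gamma> \<tau> \<in> {z. 0 < Im z}"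
      using near_before[of "{z. 0 < Im z}"] by blast
    then have s': "0 < Im (\<gamma> \<tau>)" if "\<tau> \<in> {s..t0}" for \<tau>
      using that by simp
    have "\<gamma> \<tau> \<notin> \<real>\<^sub>\<le>\<^sub>0" if "\<tau> \<in> {s..t0}" for \<tau>
      using s'[OF that] by (simp add: complex_nonpos_Reals_iff)
    then have "Arg (\<gamma> s) \<le> Arg (\<gamma> t0)"
      using s(1,2) t0ab by (intro Arg_mono) auto
    moreover have "Arg (\<gamma> t0) \<le> pi / 2"
      using Arg_Re_nonneg[of "\<gamma> t0"] t0ab(4) by (auto simp: quadrant_def)
    moreover have "0 \<le> Arg (\<gamma> s)"
      using s(2) s'[of s] by (simp add: Arg_less_0)
    moreover have "\<not> \<bar>Arg (\<gamma> s)\<bar> \<le> pi / 2"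
      using s(2,3) s'[of s] by (subst Arg_Re_nonneg) (auto simp: quadrant_def)
    ultimately show False by linarith
  qed
  ultimately have sin0: "0 < sin (phase (cmod (\<gamma> t0)))"
    using reg[OF t0ab(3)] t0ab(4) by (auto simp: region_def)
  define E where "E = {s\<in>{t0..b}. \<gamma> s \<notin> quadrant}"
  \<comment> \<open>The end of the first stay in the quadrant. Closedness of the quadrant puts
    \<open>\<gamma> t1\<close> inside it as well.\<close>
  define t1 where "t1 = Inf E"
  have E: "E \<noteq> {}" "bdd_below E"
    using t0ab ends by (auto simp: E_def bdd_below_def)
  have t1: "t0 \<le> t1" "t1 \<le> b"
    unfolding t1_def using E t0ab ends
    by (auto intro!: cInf_greatest cInf_lower simp: E_def)
  then have t1ab: "t1 \<in> {a..b}"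
    using t0ab by auto
  have inside: "\<gamma> s \<in> quadrant" if "t0 \<le> s" "s < t1" for s
    using cInf_lower[of s E] E(2) that t1(2) by (force simp: t1_def E_def)
  have t1q: "\<gamma> t1 \<in> quadrant"
  proof (rule ccontr)
    assume *: "\<gamma> t1 \<notin> quadrant"
    then have "t0 < t1"
      using t0ab(4) t1 by (cases "t0 = t1") auto
    moreover have "open (- quadrant)" "\<gamma> t1 \<in> - quadrant"
      using closed_quadrant * by auto
    then obtain e where e: "e > 0" "\<And>s. s \<in> {a..b} \<Longrightarrow> \<bar>s - t1\<bar> < e \<Longrightarrow> \<gamma> s \<in> - quadrant"
      using continuous_on_nearby[OF cont t1ab] by blast
    ultimately show False
      using inside[of "max t0 (t1 - e / 2)"] e(2)[of "max t0 (t1 - e / 2)"] t0ab t1 by auto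
  qed
  have stay: "\<gamma> s \<in> quadrant" if "s \<in> {t0..t1}" for s
    using inside[of s] t1q that by (cases "s = t1") auto
  have cm: "1 < cmod (\<gamma> s)" "cos (phase (cmod (\<gamma> s))) \<noteq> 1" if "s \<in> {t0..t1}" for s
    using reg[of s] stay[OF that] that t0ab t1 by (auto simp: region_def)
  \<comment> \<open>The phase only decreases along the path, so losing the positive sign would force
    it, by the intermediate value theorem, through a removed arc.\<close>
  have "0 < sin (phase (cmod (\<gamma> t1)))"
  proof (rule ccontr)
    assume "\<not> 0 < sin (phase (cmod (\<gamma> t1)))"
    moreover have "phase (cmod (\<gamma> t1)) \<le> phase (cmod (\<gamma> t0))"
      using cm(1)[of t0] t1 t0ab by (intro phase_antimono mono) auto
    ultimately obtain v where v: "phase (cmod (\<gamma> t1)) \<le> v" "v \<le> phase (cmod (\<gamma> t0))" "cos v = 1"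
      using cos_eq_1_between[of "phase (cmod (\<gamma> t1))" "phase (cmod (\<gamma> t0))"] sin0 by auto
    have "continuous_on {t0..t1} (\<lambda>s. phase (cmod (\<gamma> s)))"
      using t0ab t1 cm(1)
      by (intro continuous_on_compose2[OF continuous_on_phase] continuous_intros continuous_on_subset[OF cont]) auto
    then obtain s where "t0 \<le> s" "s \<le> t1" "phase (cmod (\<gamma> s)) = v"
      using IVT2'[of "\<lambda>s. phase (cmod (\<gamma> s))" t1 v t0] v t1 by auto
    then show False
      using cm(2)[of s] v(3) by auto
  qed
  then have "Re (\<gamma> t1) \<noteq> 0"
    using reg[OF t1ab] t1q by (auto simp: region_def)
  then have "0 < Re (\<gamma> t1)"
    using t1q by (auto simp: quadrant_def)
  moreover have "open {z. 0 < Re z}"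
    by (intro open_Collect_less continuous_intros)
  ultimately obtain e where e: "e > 0" "\<And>s. s \<in> {a..b} \<Longrightarrow> \<bar>s - t1\<bar> < e \<Longrightarrow> 0 < Re (\<gamma> s)"
    using continuous_on_nearby[OF cont t1ab, of "{z. 0 < Re z}"] by auto
  have "t1 < t1 + e"
    using e(1) by simp
  \<comment> \<open>Shortly after \<open>t1\<close> the path is outside the quadrant but still has
    positive real part, hence negative angle, although the angle was nonnegative at
    \<open>t1\<close>.\<close>
  then obtain s where s: "s \<in> E" "s < t1 + e"
    using cInf_lessD[OF E(1)] unfolding t1_def by blast
  have "t1 \<le> s"
    using cInf_lower[OF s(1) E(2)] by (simp add: t1_def)
  have near: "0 < Re (\<gamma> \<tau>)" if "\<tau> \<in> {t1..s}" for \<tau>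
    using that s t0ab t1 by (intro e(2)) (auto simp: E_def)
  have "Arg (\<gamma> t1) \<le> Arg (\<gamma> s)"
  proof (rule Arg_mono)
    show "\<gamma> \<tau> \<notin> \<real>\<^sub>\<le>\<^sub>0" if "\<tau> \<in> {t1..s}" for \<tau>
      using near[OF that] by (simp add: complex_nonpos_Reals_iff)
  qed (use \<open>t1 \<le> s\<close> s(1) t1ab in \<open>auto simp: E_def\<close>)
  moreover have "0 \<le> Arg (\<gamma> t1)"
    using t1q by (simp add: Arg_less_0 quadrant_def)
  moreover have "Arg (\<gamma> s) < 0"
    using s(1) near[of s] \<open>t1 \<le> s\<close> by (simp add: Arg_neg_iff E_def quadrant_def)
  ultimately show False by linarith
qed

text \<open>Allowing \<open>a = b\<close> makes the relation reflexive on \<open>region\<close>,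
  matching \<open>causal_future\<close>.\<close>

definition path_rel :: "complex rel" where
  "path_rel = {(z, w). \<exists>\<gamma> a b. a \<le> b \<and> causal_path \<gamma> a b \<and> \<gamma> a = z \<and> \<gamma> b = w}"

lemma path_relE:
  assumes "(z, w) \<in> path_rel"
  obtains \<gamma> a b where "causal_path \<gamma> a b" "a \<le> b" "\<gamma> a = z" "\<gamma> b = w"
  using assms unfolding path_rel_def by auto

lemma cmod_mono_path_rel:
  assumes "(z, w) \<in> path_rel"
  shows "cmod z \<le> cmod w"
  using path_relE[OF assms] causal_path_cmod_mono by (metis order_refl)

text \<open>\<open>Arg (- z)\<close> is, up to a shift, the angle cut along the positive real axis.
  That axis lies in the quadrant, which the whole path avoids.\<close>

lemma Arg_uminus_mono_path_rel:
  assumes "(z, w) \<in> path_rel" and ends: "z \<notin> quadrant" "w \<notin> quadrant"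
  shows "Arg (- z) \<le> Arg (- w)"
proof -
  obtain \<gamma> a b where path: "causal_path \<gamma> a b" "a \<le> b" "\<gamma> a = z" "\<gamma> b = w"
    using path_relE[OF assms(1)] .
  have "- 1 * \<gamma> \<tau> \<notin> \<real>\<^sub>\<le>\<^sub>0" if "\<tau> \<in> {a..b}" for \<tau>
    using causal_path_avoids_quadrant[OF path(1) _ _ that] path(3,4) ends
    by (auto simp: complex_nonpos_Reals_iff quadrant_def)
  then have "Arg (- 1 * \<gamma> a) \<le> Arg (- 1 * \<gamma> b)"
    using path by (intro causal_path_Arg_mono) auto
  then show ?thesis using path(3,4) by simp
qed

text \<open>The radius stays above 1, where the negative real axis is removed, so the path never
  meets the cut of \<open>Arg\<close>.\<close>

lemma Arg_mono_path_rel: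
  assumes "(z, w) \<in> path_rel" and "1 < cmod z"
  shows "Arg z \<le> Arg w"
proof -
  obtain \<gamma> a b where path: "causal_path \<gamma> a b" "a \<le> b" "\<gamma> a = z" "\<gamma> b = w"
    using path_relE[OF assms(1)] .
  have "1 * \<gamma> \<tau> \<notin> \<real>\<^sub>\<le>\<^sub>0" if "\<tau> \<in> {a..b}" for \<tau>
  proof -
    have "cmod (\<gamma> a) \<le> cmod (\<gamma> \<tau>)" "\<gamma> \<tau> \<in> region"
      using that causal_path_cmod_mono[OF path(1)] causal_path_in_region[OF path(1)] by auto
    then show ?thesis
      using assms(2) path(3) by (auto simp: complex_nonpos_Reals_iff region_def)
  qed
  then have "Arg (1 * \<gamma> a) \<le> Arg (1 * \<gamma> b)"
    using path by (intro causal_path_Arg_mono) auto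
  then show ?thesis using path(3,4) by simp
qed

section \<open>Monotone quantities on the closure of \<open>path_rel\<close>\<close>

lemma closure_relE:
  fixes R :: "complex rel"
  assumes "(z, w) \<in> closure R"
  obtains x y where "\<forall>k::nat. (x k, y k) \<in> R" "x \<longlonglongrightarrow> z" "y \<longlonglongrightarrow> w"
proof -
  obtain p where p: "\<forall>k::nat. p k \<in> R" "p \<longlonglongrightarrow> (z, w)"
    using assms unfolding closure_sequential by (elim exE conjE)
  show ?thesis
    using p tendsto_fst[OF p(2)] tendsto_snd[OF p(2)]
    by (intro that[of "\<lambda>k. fst (p k)" "\<lambda>k. snd (p k)"]) simp_all
qed

lemma cmod_mono_closure_path_rel:
  assumes "(z, w) \<in> closure path_rel"
  shows "cmod z \<le> cmod w"
proof -
  obtain x y where xy: "\<forall>k::nat. (x k, y k) \<in> path_rel" "x \<longlonglongrightarrow> z" "y \<longlonglongrightarrow> w"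
    by (rule closure_relE[OF assms])
  then show ?thesis
    using cmod_mono_path_rel by (intro LIMSEQ_le[OF tendsto_norm[OF xy(2)] tendsto_norm[OF xy(3)]]) blast
qed

text \<open>The complement of the quadrant is open, so approximating pairs eventually have both ends
  in it, and this branch of the angle is continuous there.\<close>

lemma Arg_uminus_mono_closure_path_rel:
  assumes "(z, w) \<in> closure path_rel" "z \<notin> quadrant" "w \<notin> quadrant"
  shows "Arg (- z) \<le> Arg (- w)"
proof -
  obtain x y where xy: "\<forall>k::nat. (x k, y k) \<in> path_rel" "x \<longlonglongrightarrow> z" "y \<longlonglongrightarrow> w"
    by (rule closure_relE[OF assms(1)])
  have lim: "(\<lambda>k. Arg (- f k)) \<longlonglongrightarrow> Arg (- p)" if "f \<longlonglongrightarrow> p" "p \<notin> quadrant" for f :: "nat \<Rightarrow> complex" and p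
  proof (rule isCont_tendsto_compose[of _ Arg])
    show "isCont Arg (- p)"
      using that(2) by (intro continuous_at_Arg) (auto simp: complex_nonpos_Reals_iff quadrant_def)
  qed (rule tendsto_minus[OF that(1)])
  have ev: "\<forall>\<^sub>F k in sequentially. f k \<in> - quadrant" if "f \<longlonglongrightarrow> p" "p \<notin> quadrant" for f :: "nat \<Rightarrow> complex" and p
    using that(2) by (intro topological_tendstoD[OF that(1)] open_Compl closed_quadrant) auto
  have "\<forall>\<^sub>F k in sequentially. Arg (- x k) \<le> Arg (- y k)"
    using ev[OF xy(2) assms(2)] ev[OF xy(3) assms(3)]
    by eventually_elim (rule Arg_uminus_mono_path_rel[OF xy(1)[rule_format]]; simp)
  then show ?thesis
    by (rule tendsto_le[OF trivial_limit_sequentially lim[OF xy(3) assms(3)] lim[OF xy(2) assms(2)]])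
qed

text \<open>Approximating starts eventually have radius above 1; both limits lie in
  \<open>region\<close> at such radii, hence off the cut of \<open>Arg\<close>.\<close>

lemma Arg_mono_closure_path_rel:
  assumes "(z, w) \<in> closure path_rel" "z \<in> region" "w \<in> region" "1 < cmod z" "1 < cmod w"
  shows "Arg z \<le> Arg w"
proof -
  obtain x y where xy: "\<forall>k::nat. (x k, y k) \<in> path_rel" "x \<longlonglongrightarrow> z" "y \<longlonglongrightarrow> w"
    by (rule closure_relE[OF assms(1)])
  have lim: "(\<lambda>k. Arg (f k)) \<longlonglongrightarrow> Arg p" if "f \<longlonglongrightarrow> p" "p \<in> region" "1 < cmod p" for f :: "nat \<Rightarrow> complex" and p
  proof (rule isCont_tendsto_compose[of _ Arg])
    show "isCont Arg p"
      using that(2,3) by (intro continuous_at_Arg) (auto simp: complex_nonpos_Reals_iff region_def)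
  qed (rule that(1))
  have "\<forall>\<^sub>F k in sequentially. Arg (x k) \<le> Arg (y k)"
    using order_tendstoD(1)[OF tendsto_norm[OF xy(2)] assms(4)]
    by eventually_elim (rule Arg_mono_path_rel[OF xy(1)[rule_format]])
  then show ?thesis
    by (rule tendsto_le[OF trivial_limit_sequentially lim[OF xy(3) assms(3,5)] lim[OF xy(2) assms(2,4)]])
qed

section \<open>The spacetime\<close>

definition to_complex :: "(nat \<Rightarrow> real) \<Rightarrow> complex" where
  "to_complex p = Complex (p 0) (p 1)"

definition of_complex :: "complex \<Rightarrow> nat \<Rightarrow> real" where
  "of_complex z = (\<lambda>i. if i = 0 then Re z else if i = 1 then Im z else 0)"

text \<open>The region transported to the model space, so that a single identity chart covers the
  manifold.\<close>

definition carrier :: "(nat \<Rightarrow> real) set" where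
  "carrier = {p. (\<forall>i\<ge>2. p i = 0) \<and> to_complex p \<in> region}"

lemma to_complex_of_complex [simp]: "to_complex (of_complex z) = z"
  by (simp add: to_complex_def of_complex_def)

lemma of_complex_0 [simp]: "of_complex z 0 = Re z" and of_complex_1 [simp]: "of_complex z (Suc 0) = Im z"
  by (simp_all add: of_complex_def)

lemma Re_to_complex [simp]: "Re (to_complex p) = p 0" and Im_to_complex [simp]: "Im (to_complex p) = p (Suc 0)"
  by (simp_all add: to_complex_def)

lemma of_complex_to_complex: "p \<in> carrier \<Longrightarrow> of_complex (to_complex p) = p"
  by (auto simp: carrier_def of_complex_def fun_eq_iff)

lemma of_complex_in_carrier [simp]: "of_complex z \<in> carrier \<longleftrightarrow> z \<in> region"
  by (simp add: carrier_def) (simp add: of_complex_def)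

lemma carrier_eq_image: "carrier = of_complex ` region"
proof (rule set_eqI, rule iffI)
  show "p \<in> of_complex ` region" if "p \<in> carrier" for p
    using that of_complex_to_complex[OF that] by (intro image_eqI[of _ _ "to_complex p"]) (auto simp: carrier_def)
qed auto

lemma continuous_on_to_complex: "continuous_on S to_complex"
proof -
  have "to_complex = (\<lambda>p. of_real (p 0) + \<i> * of_real (p 1))"
    by (auto simp: fun_eq_iff complex_eq_iff)
  moreover have "continuous_on S (\<lambda>p :: nat \<Rightarrow> real. complex_of_real (p 0) + \<i> * of_real (p 1))"
    by (intro continuous_intros continuous_on_subset[OF continuous_on_product_coordinates]) auto
  ultimately show ?thesis
    by metis
qed

lemma continuous_on_of_complex: "continuous_on S of_complex"
proof (rule continuous_on_coordinatewise_then_product)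
  show "continuous_on S (\<lambda>z. of_complex z i)" for i
    unfolding of_complex_def by (cases "i = 0"; cases "i = 1") (auto intro!: continuous_intros)
qed

lemma openin_carrier: "openin (Euclidean_space 2) carrier"
proof -
  have "open (to_complex -` region)"
    using open_region continuous_on_to_complex by (rule open_vimage)
  moreover have "carrier = {x. \<forall>i\<ge>2. x i = 0} \<inter> to_complex -` region"
    by (auto simp: carrier_def)
  ultimately show ?thesis
    by (auto simp: Euclidean_space_eq_top_of_set openin_open)
qed

text \<open>In polar coordinates the quadratic form is \<open>- r\<^sup>3 dr d\<theta>\<close>; its null directions are the
  radial and the angular one, and the time orientation makes both coordinates increase.\<close>

definition polar_spacetime :: "(nat \<Rightarrow> real) spacetime_data" where
  "polar_spacetime =
     \<lparr>dim = 2, topol = top_of_set carrier, atlas = {(carrier, \<lambda>p. p)},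
      metric = (\<lambda>c p i j. if i = j then (if i = 0 then 1 else - 1) * (p 0 * p 1)
                          else (- 1 / 2) * (p 0 * p 0 - p 1 * p 1)),
      time_field = (\<lambda>c p i. if i = 0 then p 0 - p 1 else p 0 + p 1)\<rparr>"

lemma polar_spacetime_simps [simp]:
  "dim polar_spacetime = 2" "topol polar_spacetime = top_of_set carrier"
  "atlas polar_spacetime = {(carrier, \<lambda>p. p)}"
  by (simp_all add: polar_spacetime_def)

lemma all_less_2: "(\<forall>i<2. P i) \<longleftrightarrow> P 0 \<and> P (Suc 0)"
  by (auto simp: numeral_2_eq_2 All_less_Suc)

text \<open>The two kinds of factors are \<open>r dr\<close> and \<open>r^2 d\<theta>\<close>
  applied to a vector; the metric is minus their symmetrized product.\<close>

lemma gprod_polar_spacetime: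
  "gprod polar_spacetime c p u v =
     - ((p 0 * u 0 + p 1 * u 1) * (p 0 * v 1 - p 1 * v 0) +
        (p 0 * u 1 - p 1 * u 0) * (p 0 * v 0 + p 1 * v 1)) / 2"
  unfolding gprod_def by (simp add: polar_spacetime_def numeral_2_eq_2 field_simps)

text \<open>On the time field both \<open>r dr\<close> and \<open>r^2 d\<theta>\<close> equal
  \<open>r^2\<close>, so its product with \<open>v\<close> tests the sign of the sum of the two
  components of \<open>v\<close>.\<close>

lemma gprod_time_field:
  "gprod polar_spacetime c p (time_field polar_spacetime c p) v =
     - (p 0 ^ 2 + p 1 ^ 2) * ((p 0 * v 1 - p 1 * v 0) + (p 0 * v 0 + p 1 * v 1)) / 2"
  unfolding gprod_polar_spacetime
  by (simp add: polar_spacetime_def power2_eq_square field_simps)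

text \<open>The origin, where the metric would degenerate, belongs to the quadrant and is removed
  with the unit disc.\<close>

lemma carrier_nonzero:
  assumes "p \<in> carrier"
  shows "0 < p 0 ^ 2 + p 1 ^ 2"
proof (rule ccontr)
  assume "\<not> ?thesis"
  then have "p 0 = 0" "p (Suc 0) = 0"
    by (simp_all add: sum_power2_gt_zero_iff)
  then show False
    using assms by (auto simp: carrier_def region_def quadrant_def)
qed

lemma chart_inv_id: "x \<in> carrier \<Longrightarrow> inv_into carrier (\<lambda>p. p) x = x"
  using inv_into_f_f[of "\<lambda>p. p" carrier x] by simp

lemma jacobian_id:
  assumes "p \<in> carrier" "i < 2"
  shows "jacobian (carrier, \<lambda>p. p) (carrier, \<lambda>p. p) p k i = (if k = i then 1 else 0)"
proof -
  have "partial_deriv i (\<lambda>x. transition (carrier, \<lambda>p. p) (carrier, \<lambda>p. p) x k) p = partial_deriv i (\<lambda>x. x k) p"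
    using assms by (intro partial_deriv_cong[OF openin_carrier]) (auto simp: transition_def chart_inv_id)
  also have "\<dots> = (if k = i then 1 else 0)"
    by (auto simp: partial_deriv_def)
  finally show ?thesis
    by (simp add: jacobian_def)
qed

lemma Cr_manifold_polar_spacetime: "Cr_manifold r 2 (top_of_set carrier) {(carrier, \<lambda>p. p)}"
proof -
  have "Cr_on 2 r carrier (\<lambda>x. transition (carrier, \<lambda>p. p) (carrier, \<lambda>p. p) x k)" for k
    by (rule Cr_on_eq_polynomial_fun[OF openin_carrier polynomial_fun.coord[of k]])
      (simp add: transition_def chart_inv_id)
  moreover have "second_countable (top_of_set carrier)"
  proof -
    obtain B :: "(nat \<Rightarrow> real) set set" where B: "countable B" "\<And>C. C \<in> B \<Longrightarrow> open C"
      "\<And>S. open S \<Longrightarrow> \<exists>U. U \<subseteq> B \<and> S = \<Union>U"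
      using univ_second_countable by blast
    have "\<exists>V\<in>B. x \<in> V \<and> V \<subseteq> U" if U: "open U" "x \<in> U" for U x
    proof -
      obtain \<U> where "\<U> \<subseteq> B" "U = \<Union>\<U>"
        using B(3)[OF U(1)] by (elim exE conjE)
      then show ?thesis
        using U(2) by blast
    qed
    then have "second_countable (euclidean :: (nat \<Rightarrow> real) topology)"
      unfolding second_countable_def using B(1,2) by (intro exI[of _ B]) simp
    then show ?thesis
      by (rule second_countable_subtopology)
  qed
  moreover have "is_chart 2 (top_of_set carrier) (carrier, \<lambda>p. p)"
  proof -
    have "subtopology (Euclidean_space 2) carrier = top_of_set carrier"
      by (auto simp: Euclidean_space_eq_top_of_set subtopology_subtopology carrier_def intro!: arg_cong[of _ _ top_of_set])
    then show ?thesis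
      using openin_carrier homeomorphic_map_id[unfolded id_def, of "top_of_set carrier" "top_of_set carrier"]
      by (simp add: is_chart_def subtopology_subtopology)
  qed
  moreover have "Hausdorff_space (top_of_set carrier)"
    by (intro Hausdorff_space_subtopology) simp
  ultimately show ?thesis
    by (simp add: Cr_manifold_def)
qed

lemma polynomial_metric: "polynomial_fun (\<lambda>p. metric polar_spacetime c p i j)"
  unfolding polar_spacetime_def spacetime_data.simps
  by (intro polynomial_fun_If polynomial_fun_diff polynomial_fun.intros)

lemma polynomial_time_field: "polynomial_fun (\<lambda>p. time_field polar_spacetime c p i)"
  unfolding polar_spacetime_def spacetime_data.simps
  by (intro polynomial_fun_If polynomial_fun_diff polynomial_fun.intros)

lemma lorentzian_metric_polar_spacetime: "lorentzian_metric s polar_spacetime"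
proof -
  let ?c = "(carrier, \<lambda>p. p) :: (nat \<Rightarrow> real) chart"
  have frame: "\<exists>e :: nat \<Rightarrow> nat \<Rightarrow> real. \<forall>i<2. \<forall>j<2.
      gprod polar_spacetime c p (e i) (e j) = (if i = j then if i = 0 then -1 else 1 else 0)"
    if "p \<in> carrier" for c p
  proof -
    define \<rho> where "\<rho> = p 0 ^ 2 + p 1 ^ 2"
    have "\<rho> \<noteq> 0"
      using carrier_nonzero[OF that] unfolding \<rho>_def by linarith
    \<comment> \<open>Solved from the prescribed radial and angular components: (1, 1) for
      \<open>e 0\<close> and (-1, 1) for \<open>e 1\<close>. The form, minus the product of the
      components, is then -1 and 1.\<close>
    define e where "e i k = (if i = (0::nat) then if k = (0::nat) then p 0 - p 1 else p 0 + p 1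
      else if k = 0 then - p 1 - p 0 else p 0 - p 1) / \<rho>" for i k
    have e: "p 0 * e 0 0 + p 1 * e 0 1 = 1" "p 0 * e 0 1 - p 1 * e 0 0 = 1"
      "p 0 * e 1 0 + p 1 * e 1 1 = - 1" "p 0 * e 1 1 - p 1 * e 1 0 = 1"
      using \<open>\<rho> \<noteq> 0\<close> by (simp_all add: e_def divide_simps) (simp_all add: \<rho>_def power2_eq_square algebra_simps)
    show ?thesis
      by (rule exI[of _ e]) (use e in \<open>simp add: all_less_2 gprod_polar_spacetime\<close>)
  qed
  have smooth: "Cr_on 2 s carrier (\<lambda>x. metric polar_spacetime ?c (inv_into carrier (\<lambda>p. p) x) i j)" for i j
    by (rule Cr_on_eq_polynomial_fun[OF openin_carrier polynomial_metric]) (simp add: chart_inv_id)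
  show ?thesis
    unfolding lorentzian_metric_def
    using frame smooth
    by (simp add: jacobian_id all_less_2) (simp add: polar_spacetime_def numeral_2_eq_2 jacobian_id)
qed

lemma time_orientation_polar_spacetime: "time_orientation polar_spacetime"
proof -
  let ?c = "(carrier, \<lambda>p. p) :: (nat \<Rightarrow> real) chart"
  have "Cr_on 2 0 carrier (\<lambda>x. time_field polar_spacetime ?c (inv_into carrier (\<lambda>p. p) x) i)" for i
    by (rule Cr_on_eq_polynomial_fun[OF openin_carrier polynomial_time_field]) (simp add: chart_inv_id)
  moreover have "gprod polar_spacetime c p (time_field polar_spacetime c p) (time_field polar_spacetime c p) < 0"
    if "p \<in> carrier" for c p
  proof -
    have "gprod polar_spacetime c p (time_field polar_spacetime c p) (time_field polar_spacetime c p) =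
        - ((p 0 ^ 2 + p 1 ^ 2) ^ 2)"
      unfolding gprod_time_field by (simp add: polar_spacetime_def power2_eq_square field_simps)
    then show ?thesis
      using zero_less_power[OF carrier_nonzero[OF that], of 2] by linarith
  qed
  moreover have "time_field polar_spacetime ?c p k =
      (\<Sum>i<2. jacobian ?c ?c p k i * time_field polar_spacetime ?c p i)" if "p \<in> carrier" "k < 2" for p k
  proof -
    have "k = 0 \<or> k = 1"
      using that(2) by auto
    then show ?thesis
      using that(1) by (elim disjE) (simp_all add: jacobian_id numeral_2_eq_2)
  qed
  ultimately show ?thesis
    unfolding time_orientation_def by simp
qed

text \<open>Polynomial components make the same example serve every regularity
  \<open>r\<close>.\<close>

lemma spacetime_polar_spacetime: "spacetime r polar_spacetime"
proof -
  have "connected carrier"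
    unfolding carrier_eq_image
    by (intro connected_continuous_image continuous_on_of_complex connected_region)
  moreover have "- \<i> \<in> region"
    by (simp add: region_def quadrant_def)
  then have "carrier \<noteq> {}"
    by (auto simp: carrier_eq_image)
  ultimately show ?thesis
    by (simp add: spacetime_def Cr_manifold_polar_spacetime lorentzian_metric_polar_spacetime
        time_orientation_polar_spacetime connected_space_subtopology)
qed

section \<open>Causal curves of the spacetime are causal paths\<close>

lemma has_vector_derivative_Re_Im:
  assumes "(\<gamma> has_vector_derivative d) F"
  shows "((\<lambda>s. Re (\<gamma> s)) has_real_derivative Re d) F" "((\<lambda>s. Im (\<gamma> s)) has_real_derivative Im d) F"
  using bounded_linear.has_vector_derivative[OF bounded_linear_Re assms]
    bounded_linear.has_vector_derivative[OF bounded_linear_Im assms]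
  by (simp_all add: has_real_derivative_iff_has_vector_derivative)

text \<open>The real and imaginary parts of \<open>cnj (\<gamma> t) * d t\<close> are
  \<open>r r'\<close> and \<open>r^2 \<theta>'\<close>. Their signs control the derivatives of the
  squared modulus and of the imaginary part of the logarithm.\<close>

lemma causal_path_if_derivative:
  assumes cont: "continuous_on {a..b} \<gamma>" and reg: "\<gamma> ` {a..b} \<subseteq> region"
    and deriv: "\<And>t. a < t \<Longrightarrow> t < b \<Longrightarrow> (\<gamma> has_vector_derivative d t) (at t)"
    and radial: "\<And>t. a < t \<Longrightarrow> t < b \<Longrightarrow> 0 \<le> Re (cnj (\<gamma> t) * d t)"
    and angular: "\<And>t. a < t \<Longrightarrow> t < b \<Longrightarrow> 0 \<le> Im (cnj (\<gamma> t) * d t)"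
  shows "causal_path \<gamma> a b"
  unfolding causal_path_def
proof (intro conjI allI impI)
  fix s t assume st: "a \<le> s \<and> s \<le> t \<and> t \<le> b"
  have cont': "continuous_on {s..t} \<gamma>"
    using st by (intro continuous_on_subset[OF cont]) auto
  have "Re (\<gamma> s) ^ 2 + Im (\<gamma> s) ^ 2 \<le> Re (\<gamma> t) ^ 2 + Im (\<gamma> t) ^ 2"
  proof (rule DERIV_nonneg_imp_increasing_open[where f = "\<lambda>x. Re (\<gamma> x) ^ 2 + Im (\<gamma> x) ^ 2"])
    fix x assume x: "s < x" "x < t"
    then have ab: "a < x" "x < b" using st by auto
    have "((\<lambda>x. Re (\<gamma> x) ^ 2 + Im (\<gamma> x) ^ 2) has_real_derivative 2 * Re (cnj (\<gamma> x) * d x)) (at x)"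
      by (rule derivative_eq_intros has_vector_derivative_Re_Im[OF deriv[OF ab]] refl | simp add: algebra_simps)+
    then show "\<exists>y. ((\<lambda>x. Re (\<gamma> x) ^ 2 + Im (\<gamma> x) ^ 2) has_real_derivative y) (at x) \<and> 0 \<le> y"
      using radial[OF ab] by (intro exI[of _ "2 * Re (cnj (\<gamma> x) * d x)"]) simp
  qed (use st in \<open>auto intro!: continuous_intros cont'\<close>)
  then show "cmod (\<gamma> s) \<le> cmod (\<gamma> t)"
    by (simp add: cmod_def)
next
  fix w s t
  assume st: "a \<le> s \<and> s \<le> t \<and> t \<le> b \<and> (\<forall>\<tau>\<in>{s..t}. w * \<gamma> \<tau> \<notin> \<real>\<^sub>\<le>\<^sub>0)"
  have nz: "w * \<gamma> \<tau> \<noteq> 0" if "\<tau> \<in> {s..t}" for \<tau>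
    using st that by force
  have cont': "continuous_on {s..t} (\<lambda>x. Im (Ln (w * \<gamma> x)))"
    using st by (intro continuous_intros continuous_on_Ln' continuous_on_subset[OF cont]) auto
  have "Im (Ln (w * \<gamma> s)) \<le> Im (Ln (w * \<gamma> t))"
  proof (rule DERIV_nonneg_imp_increasing_open[OF _ _ cont'])
    fix x assume x: "s < x" "x < t"
    then have ab: "a < x" "x < b" using st by auto
    have notin: "w * \<gamma> x \<notin> \<real>\<^sub>\<le>\<^sub>0" and "w * \<gamma> x \<noteq> 0"
      using st x nz[of x] by auto
    have "((\<lambda>x. w * \<gamma> x) has_vector_derivative w * d x) (at x)"
      using deriv[OF ab] by (rule has_vector_derivative_mult_right)
    moreover have "(Ln has_field_derivative inverse (w * \<gamma> x)) (at (w * \<gamma> x) within S)" for S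
      using has_field_derivative_Ln[OF notin] by (rule has_field_derivative_at_within)
    ultimately have "((Ln \<circ> (\<lambda>x. w * \<gamma> x)) has_vector_derivative w * d x * inverse (w * \<gamma> x)) (at x)"
      by (rule field_vector_diff_chain_within)
    \<comment> \<open>The rotation \<open>w\<close> cancels in the logarithmic derivative, so one
      estimate handles every branch.\<close>
    moreover have "w * d x * inverse (w * \<gamma> x) = d x / \<gamma> x"
      using \<open>w * \<gamma> x \<noteq> 0\<close> by (simp add: field_simps)
    ultimately have "((\<lambda>x. Im (Ln (w * \<gamma> x))) has_real_derivative Im (d x / \<gamma> x)) (at x)"
      using has_vector_derivative_Re_Im(2)[of "Ln \<circ> (\<lambda>x. w * \<gamma> x)"] by simp
    moreover have "0 \<le> Im (d x / \<gamma> x)"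
      using angular[OF ab] by (simp add: Im_divide divide_nonneg_nonneg algebra_simps)
    ultimately show "\<exists>y. ((\<lambda>x. Im (Ln (w * \<gamma> x))) has_real_derivative y) (at x) \<and> 0 \<le> y"
      by (intro exI[of _ "Im (d x / \<gamma> x)"]) simp
  qed (use st in simp)
  then show "Arg (w * \<gamma> s) \<le> Arg (w * \<gamma> t)"
    using nz[of s] nz[of t] st by (simp add: Arg_eq_Im_Ln)
qed (fact cont, fact reg)

text \<open>The metric makes the product of the two components nonnegative and the time orientation
  makes their sum positive, so neither is negative.\<close>

lemma future_causal_polar_spacetime:
  assumes "p \<in> carrier" "future_causal polar_spacetime c p v"
  shows "0 \<le> p 0 * v 0 + p 1 * v 1" "0 \<le> p 0 * v 1 - p 1 * v 0"
proof -
  have "0 \<le> (p 0 * v 0 + p 1 * v 1) * (p 0 * v 1 - p 1 * v 0)"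
    using assms(2) unfolding future_causal_def gprod_polar_spacetime by (simp add: algebra_simps)
  moreover have "0 < (p 0 * v 1 - p 1 * v 0) + (p 0 * v 0 + p 1 * v 1)"
  proof -
    have "0 < (p 0 ^ 2 + p 1 ^ 2) * ((p 0 * v 1 - p 1 * v 0) + (p 0 * v 0 + p 1 * v 1))"
      using assms(2) unfolding future_causal_def gprod_time_field by linarith
    then show ?thesis
      using carrier_nonzero[OF assms(1)] by (rule zero_less_mult_pos)
  qed
  ultimately show "0 \<le> p 0 * v 0 + p 1 * v 1" "0 \<le> p 0 * v 1 - p 1 * v 0"
    by (smt (verit) mult_nonneg_nonpos zero_le_mult_iff)+
qed

lemma causal_path_if_C1_arc:
  assumes arc: "C1_arc polar_spacetime (future_causal polar_spacetime) a b \<gamma>"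
  shows "causal_path (to_complex \<circ> \<gamma>) a b"
proof -
  have cont: "continuous_on {a..b} \<gamma>" and mem: "\<And>t. t \<in> {a..b} \<Longrightarrow> \<gamma> t \<in> carrier"
    using arc unfolding C1_arc_def by (auto simp: continuous_map_in_subtopology image_subset_iff Pi_iff)
  obtain v where v: "\<And>t i. t \<in> {a..b} \<Longrightarrow> i < 2 \<Longrightarrow> ((\<lambda>s. \<gamma> s i) has_real_derivative v t i) (at t within {a..b})"
    "\<And>t. t \<in> {a..b} \<Longrightarrow> future_causal polar_spacetime (carrier, \<lambda>p. p) (\<gamma> t) (v t)"
    using arc mem unfolding C1_arc_def by (simp add: Ball_def) metis
  show ?thesis
  proof (rule causal_path_if_derivative)
    show "continuous_on {a..b} (to_complex \<circ> \<gamma>)"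
      by (intro continuous_on_compose cont continuous_on_to_complex)
    show "(to_complex \<circ> \<gamma>) ` {a..b} \<subseteq> region"
      using mem by (auto simp: carrier_def)
  next
    fix t assume t: "a < t" "t < b"
    then have tab: "t \<in> {a..b}" by simp
    have at: "at t within {a..b} = at t"
      using t by (simp add: at_within_Icc_at)
    have "((\<lambda>s. \<gamma> s 0) has_real_derivative v t 0) (at t)" "((\<lambda>s. \<gamma> s 1) has_real_derivative v t 1) (at t)"
      using v(1)[OF tab, of 0] v(1)[OF tab, of 1] by (simp_all add: at)
    then have "((\<lambda>s. of_real (\<gamma> s 0) + \<i> * of_real (\<gamma> s 1)) has_vector_derivative
        of_real (v t 0) + \<i> * of_real (v t 1)) (at t)"
      by (intro has_vector_derivative_add has_vector_derivative_mult_right has_vector_derivative_of_real)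
    moreover have "(\<lambda>s. of_real (\<gamma> s 0) + \<i> * of_real (\<gamma> s 1)) = to_complex \<circ> \<gamma>"
      by (simp add: fun_eq_iff complex_eq_iff)
    moreover have "of_real (v t 0) + \<i> * of_real (v t 1) = to_complex (v t)"
      by (simp add: complex_eq_iff)
    ultimately show "((to_complex \<circ> \<gamma>) has_vector_derivative to_complex (v t)) (at t)"
      by simp
    show "0 \<le> Re (cnj ((to_complex \<circ> \<gamma>) t) * to_complex (v t))"
      "0 \<le> Im (cnj ((to_complex \<circ> \<gamma>) t) * to_complex (v t))"
      using future_causal_polar_spacetime[OF mem[OF tab] v(2)[OF tab]] by simp_all
  qed
qed

lemma causal_path_single:
  assumes "\<gamma> a \<in> region"
  shows "causal_path \<gamma> a a"
proof -
  have "s = a \<and> t = a" if "a \<le> s \<and> s \<le> t \<and> t \<le> a" for s t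
    using that by linarith
  then show ?thesis
    unfolding causal_path_def using assms by (intro conjI allI impI) (simp, simp, metis order_refl, metis order_refl)
qed

lemma path_rel_refl: "z \<in> region \<Longrightarrow> (z, z) \<in> path_rel"
  unfolding path_rel_def mem_Collect_eq prod.case
  by (rule exI[of _ "\<lambda>_. z"], rule exI[of _ 0], rule exI[of _ 0]) (simp add: causal_path_single)

lemma path_rel_if_causal_future:
  assumes "(p, q) \<in> causal_future polar_spacetime"
  shows "(to_complex p, to_complex q) \<in> path_rel"
proof -
  have p: "p \<in> carrier"
    using assms by (simp add: causal_future_def)
  consider "p = q" | a b \<gamma> where
    "piecewise_C1_curve polar_spacetime (future_causal polar_spacetime) a b \<gamma>" "\<gamma> a = p" "\<gamma> b = q"
    using assms unfolding causal_future_def by blast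
  then show ?thesis
  proof cases
    case 1
    then show ?thesis
      using p by (simp add: path_rel_refl carrier_def)
  next
    case 2
    then obtain m :: nat and t :: "nat \<Rightarrow> real" where t: "t 0 = a" "t m = b"
      and arcs: "\<And>j. j < m \<Longrightarrow> t j < t (Suc j) \<and>
        C1_arc polar_spacetime (future_causal polar_spacetime) (t j) (t (Suc j)) \<gamma>"
      unfolding piecewise_C1_curve_def by blast
    have "j \<le> m \<Longrightarrow> t 0 \<le> t j \<and> causal_path (to_complex \<circ> \<gamma>) (t 0) (t j)" for j
    proof (induction j)
      case 0
      have "\<gamma> (t 0) \<in> carrier"
        using p 2(2) t(1) by simp
      then show ?case
        by (simp add: causal_path_single carrier_def)
    next
      case (Suc j)
      then have IH: "t 0 \<le> t j" "causal_path (to_complex \<circ> \<gamma>) (t 0) (t j)"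
        by (simp_all only: Suc_leD)
      have step: "t j < t (Suc j)" "causal_path (to_complex \<circ> \<gamma>) (t j) (t (Suc j))"
        using arcs[of j] Suc.prems by (simp_all only: Suc_le_eq causal_path_if_C1_arc)
      show ?case
        using causal_path_join[OF IH(2) step(2)] IH(1) step(1) by (simp only: order_trans less_imp_le)
    qed
    from this[of m] have "a \<le> b" "causal_path (to_complex \<circ> \<gamma>) a b"
      using t by simp_all
    then show ?thesis
      unfolding path_rel_def mem_Collect_eq prod.case using 2(2,3)
      by (intro exI[of _ "to_complex \<circ> \<gamma>"] exI[of _ a] exI[of _ b]) simp
  qed
qed

text \<open>The closure is taken relative to the carrier; its continuous image lies in the closure
  in the whole plane, where sequences are available.\<close>

lemma A_relD:
  assumes "(p, q) \<in> A_rel polar_spacetime"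
  shows "p \<in> carrier" "q \<in> carrier" "(to_complex p, to_complex q) \<in> closure path_rel"
proof -
  let ?X = "prod_topology (top_of_set carrier) (top_of_set carrier)"
  let ?f = "\<lambda>x. (to_complex (fst x), to_complex (snd x))"
  have mem: "(p, q) \<in> ?X closure_of causal_future polar_spacetime"
    using assms by (simp add: A_rel_def)
  have "(p, q) \<in> topspace ?X"
    by (rule subsetD[OF closure_of_subset_topspace mem])
  then show "p \<in> carrier" "q \<in> carrier"
    by simp_all
  have X: "?X = top_of_set (carrier \<times> carrier)"
    by simp
  have "continuous_on (carrier \<times> carrier) ?f"
    by (intro continuous_on_Pair continuous_on_compose2[OF continuous_on_to_complex[of UNIV]] continuous_intros) auto
  then have "continuous_map ?X euclidean ?f"
    by (simp add: X)
  then have "?f (p, q) \<in> euclidean closure_of (?f ` causal_future polar_spacetime)"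
    using imageI[OF mem] by (rule subsetD[OF continuous_map_image_closure_subset])
  also have "\<dots> \<subseteq> closure path_rel"
    unfolding euclidean_closure_of using path_rel_if_causal_future
    by (intro closure_mono) auto
  finally show "(to_complex p, to_complex q) \<in> closure path_rel"
    by simp
qed

section \<open>Cycles of \<open>A_rel\<close>\<close>

lemma cyclic_nondecreasing_constant:
  fixes f :: "nat \<Rightarrow> real"
  assumes "\<And>i. i \<in> {1..k} \<Longrightarrow> f i \<le> f (i + 1)" "f (k + 1) = f 1" "i \<in> {1..k}"
  shows "f i = f 1"
proof (rule antisym)
  have mono: "f i \<le> f j" if "1 \<le> i" "i \<le> j" "j \<le> k + 1" for i j
    using that(2,3)
  proof (induction rule: dec_induct)
    case (step n)
    then show ?case
      using assms(1)[of n] that(1) by auto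
  qed simp
  show "f i \<le> f 1"
    using mono[of i "k + 1"] assms(2,3) by simp
  show "f 1 \<le> f i"
    using mono[of 1 i] assms(3) by simp
qed

lemma A_infinity_causal_polar_spacetime: "A_infinity_causal polar_spacetime"
  unfolding A_infinity_causal_def A_half_causal_def
proof (intro allI impI ballI)
  fix k i :: nat and x :: "nat \<Rightarrow> nat \<Rightarrow> real"
  assume "2 \<le> k" and x: "(\<forall>i\<in>{1..k}. (x i, x (i + 1)) \<in> A_rel polar_spacetime) \<and> x (k + 1) = x 1"
    and i: "i \<in> {1..k}"
  define z where "z j = to_complex (x j)" for j
  have A: "(x j, x (j + 1)) \<in> A_rel polar_spacetime" if "j \<in> {1..k}" for j
    using x[THEN conjunct1] that by (rule bspec)
  have carr: "x j \<in> carrier" and rel: "(z j, z (j + 1)) \<in> closure path_rel" if "j \<in> {1..k}" for j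
    unfolding z_def by (rule A_relD[OF A[OF that]])+
  have cyc: "z (k + 1) = z 1"
    unfolding z_def using x[THEN conjunct2] by (rule arg_cong)
  have "cmod (z j) = cmod (z 1)" if "j \<in> {1..k}" for j
  proof (rule cyclic_nondecreasing_constant[of k "\<lambda>j. cmod (z j)", OF _ _ that])
    show "cmod (z l) \<le> cmod (z (l + 1))" if "l \<in> {1..k}" for l
      by (rule cmod_mono_closure_path_rel[OF rel[OF that]])
  qed (simp only: cyc)
  note cm' = this
  have cm: "cmod (z j) = cmod (z 1)" if "1 \<le> j" "j \<le> k + 1" for j
  proof (cases "j = k + 1")
    case True
    then show ?thesis by (simp only: cyc)
  qed (rule cm', use that in simp)
  have reg: "z j \<in> region" if "1 \<le> j" "j \<le> k + 1" for j
  proof (cases "j = k + 1")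
    case True
    then show ?thesis
      using carr[of 1] \<open>2 \<le> k\<close> by (simp only: cyc) (simp add: carrier_def z_def)
  next
    case False
    then show ?thesis
      using carr[of j] that by (simp add: carrier_def z_def)
  qed
  have "z i = z 1"
  \<comment> \<open>With the modulus constant along the cycle, one branch of the angle serves all
    its points and determines them.\<close>
  proof (cases "1 < cmod (z 1)")
    case True
    have "Arg (z i) = Arg (z 1)"
    proof (rule cyclic_nondecreasing_constant[of k "\<lambda>j. Arg (z j)"])
      show "Arg (z j) \<le> Arg (z (j + 1))" if "j \<in> {1..k}" for j
        using that True cm[of j] cm[of "j + 1"]
        by (intro Arg_mono_closure_path_rel rel reg) simp_all
    qed (simp only: cyc, rule i)
    then show ?thesis
      using rcis_cmod_Arg[of "z i"] rcis_cmod_Arg[of "z 1"] cm[of i] i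
      unfolding atLeastAtMost_iff by (metis trans_le_add1)
  next
    case False
    have "Arg (- z i) = Arg (- z 1)"
    proof (rule cyclic_nondecreasing_constant[of k "\<lambda>j. Arg (- z j)"])
      show "Arg (- z j) \<le> Arg (- z (j + 1))" if "j \<in> {1..k}" for j
      proof (rule Arg_uminus_mono_closure_path_rel[OF rel[OF that]])
        \<comment> \<open>The region meets the quadrant only at radii above 1.\<close>
        show "z j \<notin> quadrant" "z (j + 1) \<notin> quadrant"
          using that False cm[of j] cm[of "j + 1"] reg[of j] reg[of "j + 1"] by (simp_all add: region_def)
      qed
    qed (simp only: cyc, rule i)
    then have "- z i = - z 1"
      using rcis_cmod_Arg[of "- z i"] rcis_cmod_Arg[of "- z 1"] cm[of i] i
      unfolding norm_minus_cancel atLeastAtMost_iff by (metis trans_le_add1)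
    then show ?thesis by simp
  qed
  then show "x i = x 1"
    using of_complex_to_complex[OF carr[OF i]] of_complex_to_complex[OF carr[of 1]] \<open>2 \<le> k\<close>
    by (simp add: z_def)
qed

section \<open>Failure of \<open>K\<close>-causality\<close>

text \<open>A logarithmic spiral with constant rates \<open>l\<close> of the logarithm of the radius
  and \<open>m\<close> of the angle; it is timelike because both rates are positive.\<close>

lemma spiral_in_chron_future:
  assumes "0 < r" "0 < l" "0 < m"
    and reg: "\<And>s. 0 \<le> s \<Longrightarrow> s \<le> 1 \<Longrightarrow> rcis (r * exp (l * s)) (\<alpha> + m * s) \<in> region"
  shows "(of_complex (rcis r \<alpha>), of_complex (rcis (r * exp l) (\<alpha> + m))) \<in> chron_future polar_spacetime"
proof -
  define x where "x s = r * exp (l * s) * cos (\<alpha> + m * s)" for s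
  define y where "y s = r * exp (l * s) * sin (\<alpha> + m * s)" for s
  define \<gamma> where "\<gamma> s = of_complex (rcis (r * exp (l * s)) (\<alpha> + m * s))" for s
  define v where "v s i = (if i = 0 then l * x s - m * y s else l * y s + m * x s)" for s and i :: nat
  have \<gamma>01: "\<gamma> s 0 = x s" "\<gamma> s (Suc 0) = y s" for s
    by (simp_all add: \<gamma>_def x_def y_def)
  have x': "(x has_real_derivative v s 0) (at s within S)"
    and y': "(y has_real_derivative v s (Suc 0)) (at s within S)" for s S
    unfolding x_def[abs_def] y_def[abs_def] v_def
    by (rule derivative_eq_intros refl | simp add: x_def y_def algebra_simps)+
  have "continuous_on S x" "continuous_on S y" for S
    unfolding x_def[abs_def] y_def[abs_def] by (intro continuous_intros)+
  then have v_cont: "continuous_on S (\<lambda>s. v s i)" for S i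
    unfolding v_def by (cases "i = 0") (auto intro!: continuous_intros)
  have \<gamma>_in: "\<gamma> s \<in> carrier" if "s \<in> {0..1}" for s
    using reg[of s] that by (simp add: \<gamma>_def)
  have "continuous_on {0..1} (\<lambda>s. rcis (r * exp (l * s)) (\<alpha> + m * s))"
    unfolding rcis_def cis_conv_exp by (intro continuous_intros)
  then have \<gamma>_cont: "continuous_on {0..1} \<gamma>"
    unfolding \<gamma>_def by (rule continuous_on_compose2[OF continuous_on_of_complex[of UNIV]]) simp
  have timelike: "future_timelike polar_spacetime c (\<gamma> s) (v s)" for c s
  proof -
    define \<rho> where "\<rho> = x s ^ 2 + y s ^ 2"
    have "\<rho> = (r * exp (l * s)) ^ 2 * (cos (\<alpha> + m * s) ^ 2 + sin (\<alpha> + m * s) ^ 2)"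
      by (simp only: \<rho>_def x_def y_def power_mult_distrib distrib_left)
    then have "0 < \<rho>"
      using assms(1) by simp
    have "x s * v s 0 + y s * v s 1 = l * \<rho>" "x s * v s 1 - y s * v s 0 = m * \<rho>"
      by (simp_all add: v_def \<rho>_def power2_eq_square algebra_simps)
    then have "gprod polar_spacetime c (\<gamma> s) (v s) (v s) = - (l * \<rho> * (m * \<rho>))"
      "gprod polar_spacetime c (\<gamma> s) (time_field polar_spacetime c (\<gamma> s)) (v s) = - (\<rho> * (m * \<rho> + l * \<rho>)) / 2"
      unfolding gprod_time_field unfolding gprod_polar_spacetime by (simp_all add: \<gamma>01 \<rho>_def) (simp add: algebra_simps)
    then show ?thesis
      using assms(2,3) \<open>0 < \<rho>\<close> by (simp add: future_timelike_def add_pos_pos)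
  qed
  have arc: "C1_arc polar_spacetime (future_timelike polar_spacetime) 0 1 \<gamma>"
    unfolding C1_arc_def polar_spacetime_simps
  proof (intro conjI ballI)
    show "continuous_map (top_of_set {0..1}) (top_of_set carrier) \<gamma>"
      using \<gamma>_cont \<gamma>_in by (auto simp: continuous_map_in_subtopology)
    fix c :: "(nat \<Rightarrow> real) chart"
    assume "c \<in> {(carrier, \<lambda>p. p)}"
    then have c: "c = (carrier, \<lambda>p. p)" by simp
    have "((\<lambda>s. \<gamma> s i) has_real_derivative v t i) (at t within {0..1})" if "i < 2" for i t
      using that x' y' by (auto simp: less_2_cases_iff \<gamma>01)
    then show "\<exists>v. (\<forall>t\<in>{0..1}. \<gamma> t \<in> chart_dom c \<longrightarrow>
        (\<forall>i<2. ((\<lambda>s. chart_map c (\<gamma> s) i) has_real_derivative v t i) (at t within {0..1})) \<and>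
        future_timelike polar_spacetime c (\<gamma> t) (v t)) \<and>
        (\<forall>i<2. continuous_on {t \<in> {0..1}. \<gamma> t \<in> chart_dom c} (\<lambda>t. v t i))"
      using timelike v_cont by (intro exI[of _ v]) (simp add: c)
  qed
  have "piecewise_C1_curve polar_spacetime (future_timelike polar_spacetime) 0 1 \<gamma>"
    unfolding piecewise_C1_curve_def
  proof (intro conjI exI)
    \<comment> \<open>The subdivision is the embedding \<open>real\<close> with a single
      piece.\<close>
    show "real 0 = 0" "real 1 = 1" by simp_all
    show "\<forall>j<1. real j < real (Suc j) \<and>
        C1_arc polar_spacetime (future_timelike polar_spacetime) (real j) (real (Suc j)) \<gamma>"
      using arc by simp
    show "continuous_map (top_of_set {0..1}) (topol polar_spacetime) \<gamma>"
      using arc unfolding C1_arc_def by (rule conjunct1)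
  qed simp
  moreover have "\<gamma> 0 = of_complex (rcis r \<alpha>)" "\<gamma> 1 = of_complex (rcis (r * exp l) (\<alpha> + m))"
    by (simp_all add: \<gamma>_def)
  ultimately show ?thesis
    unfolding chron_future_def mem_Collect_eq prod.case by (intro exI conjI)
qed

text \<open>\<open>R\<close> is closed only relative to the carrier, so the limits must be known to
  lie in \<open>region\<close>. The general filter covers both spirals flattening as
  \<open>l\<close> tends to 0 and sequences of radii.\<close>

lemma closedin_carrier_limit:
  assumes "closedin (prod_topology (top_of_set carrier) (top_of_set carrier)) R"
    and "F \<noteq> bot" "(x \<longlongrightarrow> z) F" "(y \<longlongrightarrow> w) F" "z \<in> region" "w \<in> region"
    and ev: "\<forall>\<^sub>F k in F. (of_complex (x k), of_complex (y k)) \<in> R"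
  shows "(of_complex z, of_complex w) \<in> R"
proof -
  obtain C where C: "closed C" "R = (carrier \<times> carrier) \<inter> C"
    using assms(1) by (auto simp: closedin_closed)
  have lim: "((\<lambda>k. of_complex (u k)) \<longlongrightarrow> of_complex a) F" if "(u \<longlongrightarrow> a) F" for u a
    using continuous_on_of_complex[of UNIV] that
    by (intro isCont_tendsto_compose[of _ of_complex]) (simp_all add: continuous_on_eq_continuous_at)
  have "(of_complex z, of_complex w) \<in> C"
  proof (rule Lim_in_closed_set[OF C(1) _ assms(2)])
    show "\<forall>\<^sub>F k in F. (of_complex (x k), of_complex (y k)) \<in> C"
      using ev by eventually_elim (simp add: C(2))
    show "((\<lambda>k. (of_complex (x k), of_complex (y k))) \<longlongrightarrow> (of_complex z, of_complex w)) F"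
      by (intro tendsto_Pair lim assms(3,4))
  qed
  then show ?thesis
    using assms(5,6) by (simp add: C(2))
qed

lemma tendsto_rcis [tendsto_intros]:
  "(f \<longlongrightarrow> r) F \<Longrightarrow> (g \<longlongrightarrow> a) F \<Longrightarrow> ((\<lambda>k. rcis (f k) (g k)) \<longlongrightarrow> rcis r a) F"
  unfolding rcis_def cis_conv_exp by (intro tendsto_intros)

lemma tendsto_mult_exp_0: "((\<lambda>l::real. r * exp (c * l)) \<longlongrightarrow> (r::real)) (at_right 0)"
  by (rule tendsto_eq_intros refl | simp)+

section \<open>Pairs forced into every closed transitive relation containing the chronological
  future\<close>

context
  fixes R :: "(nat \<Rightarrow> real) rel"
  assumes closed: "closedin (prod_topology (top_of_set carrier) (top_of_set carrier)) R"
    and trans: "trans R"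
    and chron: "chron_future polar_spacetime \<subseteq> R"
begin

text \<open>The circular arc may leave the region between its ends. It is approximated by timelike
  spirals with the same start that run at slightly larger radii.\<close>

lemma rotate_outwards:
  assumes "0 < r" "0 < m" "rcis r \<alpha> \<in> region" "rcis r (\<alpha> + m) \<in> region"
    and "r < r'" and reg: "\<And>q s. r < q \<Longrightarrow> q < r' \<Longrightarrow> 0 < s \<Longrightarrow> s \<le> 1 \<Longrightarrow> rcis q (\<alpha> + m * s) \<in> region"
  shows "(of_complex (rcis r \<alpha>), of_complex (rcis r (\<alpha> + m))) \<in> R"
proof (rule closedin_carrier_limit[OF closed, where F = "at_right (0::real)" and x = "\<lambda>_. rcis r \<alpha>" and
      y = "\<lambda>l. rcis (r * exp l) (\<alpha> + m)"])
  show "((\<lambda>l. rcis (r * exp l) (\<alpha> + m)) \<longlongrightarrow> rcis r (\<alpha> + m)) (at_right 0)"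
    using tendsto_mult_exp_0[of r 1] by (intro tendsto_intros) simp
  have "\<forall>\<^sub>F l in at_right (0::real). r * exp (1 * l) < r'"
    using order_tendstoD(2)[OF tendsto_mult_exp_0 \<open>r < r'\<close>] .
  moreover have "\<forall>\<^sub>F l in at_right (0::real). 0 < l"
    by (rule eventually_at_right_less)
  ultimately show "\<forall>\<^sub>F l in at_right 0. (of_complex (rcis r \<alpha>), of_complex (rcis (r * exp l) (\<alpha> + m))) \<in> R"
  proof eventually_elim
    case (elim l)
    have "rcis (r * exp (l * s)) (\<alpha> + m * s) \<in> region" if "0 \<le> s" "s \<le> 1" for s
    proof (cases "s = 0")
      case True
      then show ?thesis using assms(3) by simp
    next
      case False
      have "l * s \<le> l"
        using elim(2) that by (simp add: mult_left_le)
      then have "r * exp (l * s) \<le> r * exp l"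
        using assms(1) by simp
      moreover have "r < r * exp (l * s)"
        using False that elim(2) assms(1) by simp
      ultimately show ?thesis
        using False that elim(1) by (intro reg) auto
    qed
    then show ?case
      using spiral_in_chron_future[OF assms(1) elim(2) assms(2)] chron by blast
  qed
qed (use assms in simp_all)

text \<open>Here the spirals share the end point and run at slightly smaller radii.\<close>

lemma rotate_inwards:
  assumes "0 < r" "0 < m" "rcis r \<alpha> \<in> region" "rcis r (\<alpha> + m) \<in> region"
    and "r' < r" and reg: "\<And>q s. r' < q \<Longrightarrow> q < r \<Longrightarrow> 0 \<le> s \<Longrightarrow> s < 1 \<Longrightarrow> rcis q (\<alpha> + m * s) \<in> region"
  shows "(of_complex (rcis r \<alpha>), of_complex (rcis r (\<alpha> + m))) \<in> R"
proof (rule closedin_carrier_limit[OF closed, where F = "at_right (0::real)" and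
      x = "\<lambda>l. rcis (r * exp (- l)) \<alpha>" and y = "\<lambda>_. rcis r (\<alpha> + m)"])
  show "((\<lambda>l. rcis (r * exp (- l)) \<alpha>) \<longlongrightarrow> rcis r \<alpha>) (at_right 0)"
    using tendsto_mult_exp_0[of r "- 1"] by (intro tendsto_intros) simp
  have "\<forall>\<^sub>F l in at_right (0::real). r' < r * exp (- 1 * l)"
    using order_tendstoD(1)[OF tendsto_mult_exp_0 \<open>r' < r\<close>] .
  moreover have "\<forall>\<^sub>F l in at_right (0::real). 0 < l"
    by (rule eventually_at_right_less)
  ultimately show "\<forall>\<^sub>F l in at_right 0. (of_complex (rcis (r * exp (- l)) \<alpha>), of_complex (rcis r (\<alpha> + m))) \<in> R"
  proof eventually_elim
    case (elim l)
    have pos: "0 < r * exp (- l)"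
      using assms(1) by simp
    have "rcis (r * exp (- l) * exp (l * s)) (\<alpha> + m * s) \<in> region" if "0 \<le> s" "s \<le> 1" for s
    proof (cases "s = 1")
      case True
      then show ?thesis using assms(4) by (simp add: exp_minus field_simps)
    next
      case False
      have eq: "r * exp (- l) * exp (l * s) = r * exp (- l + l * s)"
        by (simp only: exp_add mult.assoc)
      have "l * s < l"
        using elim(2) that False by simp
      then have "r * exp (- l + l * s) < r"
        using assms(1) by simp
      moreover have "r * exp (- l) \<le> r * exp (- l + l * s)"
        using that elim(2) assms(1) by simp
      ultimately show ?thesis
        unfolding eq using False that elim(1) by (intro reg) auto
    qed
    from spiral_in_chron_future[OF pos elim(2) assms(2) this]
    have "(of_complex (rcis (r * exp (- l)) \<alpha>), of_complex (rcis (r * exp (- l) * exp l) (\<alpha> + m))) \<in> R"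
      using chron by blast
    moreover have "r * exp (- l) * exp l = r"
      by (simp add: exp_minus)
    ultimately show ?case
      by simp
  qed
qed (use assms in simp_all)

lemma rcis_in_region_below: "0 < r \<Longrightarrow> sin a < 0 \<Longrightarrow> rcis r a \<in> region"
  using mult_pos_neg[of r "sin a"] by (auto simp: region_def quadrant_def)

lemma rcis_in_region_left: "0 < r \<Longrightarrow> cos a < 0 \<Longrightarrow> 0 < sin a \<Longrightarrow> rcis r a \<in> region"
  using mult_pos_neg[of r "cos a"] by (auto simp: region_def quadrant_def)

text \<open>At this radius entrance and exit are both just closed. The entrance is passed at
  slightly larger radii and the exit at slightly smaller ones; transitivity joins the two limits at
  angle \<open>pi / 4\<close>.\<close>

lemma cross_room:
  assumes r: "1 < r" "sin (phase r) = 0" "cos (phase r) = - 1"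
  shows "(of_complex (rcis r (- pi / 2)), of_complex (rcis r (3 * pi / 4))) \<in> R"
proof -
  have m: "rcis r (pi / 4) \<in> region"
    using r by (simp add: region_def quadrant_def cos_45 sin_45)
  have trig: "cos (3 * pi / 4) < 0" "0 < sin (3 * pi / 4)"
    using cos_minus_pi[of "pi / 4"] cos_gt_zero_pi[of "pi / 4"] sin_gt_zero[of "3 * pi / 4"]
    by (auto simp: cos_diff)
  obtain r' where r': "r < r'" "\<And>w. r < cmod w \<Longrightarrow> cmod w < r' \<Longrightarrow> \<not> (Re w = 0 \<and> 0 \<le> Im w) \<Longrightarrow>
      \<not> (Im w = 0 \<and> Re w \<le> 0) \<Longrightarrow> w \<in> region"
    by (rule region_above[OF r(1)]) (use r in auto)
  have "(of_complex (rcis r (- pi / 2)), of_complex (rcis r (- pi / 2 + 3 * pi / 4))) \<in> R"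
  proof (rule rotate_outwards[OF _ _ _ _ r'(1)])
    show "rcis r (- pi / 2) \<in> region"
      using r(1) by (intro rcis_in_region_below) auto
    show "rcis r (- pi / 2 + 3 * pi / 4) \<in> region"
      using m by (simp add: field_simps)
    fix q s :: real assume qs: "r < q" "q < r'" "0 < s" "s \<le> 1"
    have "0 < cos (- pi / 2 + 3 * pi / 4 * s)"
      using qs(3,4) mult_left_le[of s "3 * pi / 4"] pi_gt_zero by (intro cos_gt_zero_pi) auto
    then show "rcis q (- pi / 2 + 3 * pi / 4 * s) \<in> region"
      using qs r(1) by (intro r'(2)) (auto simp: zero_less_mult_iff mult_le_0_iff)
  qed (use r in auto)
  moreover have "- pi / 2 + 3 * pi / 4 = pi / 4"
    by simp
  ultimately have 1: "(of_complex (rcis r (- pi / 2)), of_complex (rcis r (pi / 4))) \<in> R"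
    by metis
  obtain r'' where r'': "r'' < r" "1 \<le> r''" "\<And>w. r'' < cmod w \<Longrightarrow> cmod w < r \<Longrightarrow> Im w \<noteq> 0 \<Longrightarrow> w \<in> region"
    by (rule region_below[OF r(1)]) (use r in auto)
  have "(of_complex (rcis r (pi / 4)), of_complex (rcis r (pi / 4 + pi / 2))) \<in> R"
  proof (rule rotate_inwards[OF _ _ m _ r''(1)])
    have "pi / 4 + pi / 2 = 3 * pi / 4"
      by simp
    then show "rcis r (pi / 4 + pi / 2) \<in> region"
      using r(1) trig by (metis rcis_in_region_left less_trans zero_less_one)
    fix q s :: real assume qs: "r'' < q" "q < r" "0 \<le> s" "s < 1"
    have "pi / 2 * s \<le> pi / 2"
      using qs(3,4) by (intro mult_left_le) auto
    then have "0 < sin (pi / 4 + pi / 2 * s)"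
      using qs(3) pi_gt_zero by (intro sin_gt_zero add_pos_nonneg) (simp, simp, linarith)
    then show "rcis q (pi / 4 + pi / 2 * s) \<in> region"
      using qs r''(2) by (intro r''(3)) auto
  qed (use r in auto)
  moreover have "pi / 4 + pi / 2 = 3 * pi / 4"
    by simp
  ultimately have 2: "(of_complex (rcis r (pi / 4)), of_complex (rcis r (3 * pi / 4))) \<in> R"
    by metis
  show ?thesis
    using trans 1 2 by (rule transD)
qed

lemma cycle_in_closed_transitive:
  "(of_complex (rcis 1 (- pi / 2)), of_complex (rcis 1 (3 * pi / 4))) \<in> R"
  "(of_complex (rcis 1 (3 * pi / 4)), of_complex (rcis 1 (- pi / 2))) \<in> R"
proof -
  have trig: "cos (3 * pi / 4) < 0" "0 < sin (3 * pi / 4)"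
    using cos_minus_pi[of "pi / 4"] cos_gt_zero_pi[of "pi / 4"] sin_gt_zero[of "3 * pi / 4"]
    by (auto simp: cos_diff)
  \<comment> \<open>The radii whose phase is an odd multiple of \<open>pi\<close>, one in the middle
    of each of infinitely many rooms.\<close>
  define r where "r n = 1 + 1 / (2 * real n * pi + pi)" for n :: nat
  have r: "1 < r n" "phase (r n) = 2 * real n * pi + pi" for n
    by (simp_all add: r_def phase_def add_nonneg_pos)
  have lim: "r \<longlonglongrightarrow> 1"
    unfolding r_def by real_asymp
  show "(of_complex (rcis 1 (- pi / 2)), of_complex (rcis 1 (3 * pi / 4))) \<in> R"
  proof (rule closedin_carrier_limit[OF closed, where F = sequentially])
    show "(\<lambda>n. rcis (r n) (- pi / 2)) \<longlonglongrightarrow> rcis 1 (- pi / 2)"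
      "(\<lambda>n. rcis (r n) (3 * pi / 4)) \<longlonglongrightarrow> rcis 1 (3 * pi / 4)"
      by (intro tendsto_intros lim)+
    have "(of_complex (rcis (r n) (- pi / 2)), of_complex (rcis (r n) (3 * pi / 4))) \<in> R" for n
      using r(1)
    proof (rule cross_room)
      show "sin (phase (r n)) = 0" "cos (phase (r n)) = - 1"
        unfolding r(2) sin_add cos_add sin_2npi cos_2npi by simp_all
    qed
    then show "\<forall>\<^sub>F n in sequentially. (of_complex (rcis (r n) (- pi / 2)), of_complex (rcis (r n) (3 * pi / 4))) \<in> R"
      by simp
    show "rcis 1 (- pi / 2) \<in> region"
      by (intro rcis_in_region_below) auto
    show "rcis 1 (3 * pi / 4) \<in> region"
      using trig by (intro rcis_in_region_left) auto
  qed simp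
  \<comment> \<open>The way back turns from \<open>3 * pi / 4\<close> to \<open>3 * pi / 2\<close>
    across the negative real axis, which is present at radii below 1 only.\<close>
  have "(of_complex (rcis 1 (3 * pi / 4)), of_complex (rcis 1 (3 * pi / 4 + 3 * pi / 4))) \<in> R"
  proof (rule rotate_inwards[where r' = 0])
    have *: "3 * pi / 4 + 3 * pi / 4 = pi + pi / 2"
      by simp
    show "rcis 1 (3 * pi / 4 + 3 * pi / 4) \<in> region"
      unfolding * by (rule rcis_in_region_below) (simp, simp only: sin_add, simp)
    show "rcis 1 (3 * pi / 4) \<in> region"
      using trig by (intro rcis_in_region_left) auto
    fix q s :: real assume qs: "0 < q" "q < 1" "0 \<le> s" "s < 1"
    define a where "a = 3 * pi / 4 + 3 * pi / 4 * s"
    have "3 * pi / 4 * s < 3 * pi / 4" "0 \<le> 3 * pi / 4 * s"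
      using qs by simp_all
    then have "0 < cos (a - pi)"
      unfolding a_def using pi_gt_zero by (intro cos_gt_zero_pi) linarith+
    then have "cos a < 0"
      by (simp add: cos_diff)
    then show "rcis q (3 * pi / 4 + 3 * pi / 4 * s) \<in> region"
      unfolding a_def[symmetric]
      using qs mult_pos_neg[of q "cos a"] by (auto simp: region_def quadrant_def)
  qed simp_all
  moreover have "rcis 1 (3 * pi / 4 + 3 * pi / 4) = rcis 1 (- pi / 2)"
  proof -
    have "3 * pi / 4 + 3 * pi / 4 = - pi / 2 + 2 * pi"
      by simp
    then show ?thesis
      by (simp only: rcis_def cis.ctr sin_periodic cos_periodic)
  qed
  ultimately show "(of_complex (rcis 1 (3 * pi / 4)), of_complex (rcis 1 (- pi / 2))) \<in> R"
    by simp
qed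

end

lemma not_K_causal_polar_spacetime: "\<not> K_causal polar_spacetime"
proof
  assume "K_causal polar_spacetime"
  moreover have "(of_complex (rcis 1 (- pi / 2)), of_complex (rcis 1 (3 * pi / 4))) \<in> K_rel polar_spacetime"
    "(of_complex (rcis 1 (3 * pi / 4)), of_complex (rcis 1 (- pi / 2))) \<in> K_rel polar_spacetime"
    \<comment> \<open>The pairs were obtained for an arbitrary \<open>R\<close>, hence lie in the
      intersection.\<close>
    unfolding K_rel_def polar_spacetime_simps using cycle_in_closed_transitive by blast+
  ultimately have "of_complex (rcis 1 (- pi / 2)) = of_complex (rcis 1 (3 * pi / 4))"
    unfolding K_causal_def by (rule antisymD)
  then have "to_complex (of_complex (rcis 1 (- pi / 2))) = to_complex (of_complex (rcis 1 (3 * pi / 4)))"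
    by (rule arg_cong)
  then have "Im (rcis 1 (- pi / 2)) = Im (rcis 1 (3 * pi / 4))"
    by simp
  moreover have "0 < sin (3 * pi / 4)"
    by (intro sin_gt_zero) auto
  ultimately show False
    by simp
qed

theorem mainTheorem16:
  fixes r :: enat
  assumes "3 \<le> r"
  shows "\<exists>S :: (nat \<Rightarrow> real) spacetime_data.
           spacetime r S \<and> A_infinity_causal S \<and> \<not> K_causal S"
  using spacetime_polar_spacetime A_infinity_causal_polar_spacetime not_K_causal_polar_spacetime
  by blast

end
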